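(* Let $1<p<\infty$, $0<\sigma<p$ and set $\alpha=1/\sigma-1/p$. Letting $q=\min(\sigma,2)$, the approximation space $\mathcal A_q^\alpha=\mathcal A_q^\alpha(L^p(S),\Phi)$ embeds continuously into the variation space $V_{\sigma,p}$.
   Context: Setting. $(\Omega,\mathscr F,|\cdot|)$ is a probability space, $\nu\ge 2$ an integer, and $(\mathscr F_n)_{n\ge 0}$ a $\nu$-ary filtration: an increasing sequence of finite sub-$\sigma$-algebras of $\mathscr F$ with $\mathscr F_0=\{\emptyset,\Omega\}$, such that for each $n\ge1$ each atom of $\mathscr F_{n-1}$ is a union of at most $\nu$ atoms of $\mathscr F_n$; all atoms have positive measure. $\mathscr A_n$ is the set of atoms of $\mathscr F_n$ and $\mathscr A=\bigcup_n\mathscr A_n$. Elements of $\mathscr A$ are called atoms; nonempty differences $A\setminus B$ with $A,B\in\mathscr A$, $B\subsetneq A$, are called rings. $S$ is a finite-dimensional linear space of bounded $\mathscr F$-measurable scalar-valued functions on $\Omega$ for which there are constants $c_1,c_2\in(0,1]$ with $|\{\omega\in A:|f(\omega)|\ge c_1\|f\|_A\}|\ge c_2|A|$ for all $A\in\mathscr A$, $f\in S$, where $\|f\|_A$ is the $L^\infty$-norm of $f$ on $A$. For $R\in\mathscr F$, $S_R=\{f\mathbf 1_R:f\in S\}$. $\mathcal C=\{f\mathbf 1_A:f\in S,A\in\mathscr A\}$ and $L^p(S)$ is the closure of $\operatorname{span}\mathcal C$ in $L^p(\Omega)$. Local orthonormal system. $S_n$ is the space of functions coinciding on each atom of $\mathscr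 F_n$ with some element of $S$; $P_n$ is the orthogonal projection onto $S_n$ in $L^2$, $P_{-1}=0$. $\Phi=\bigcup_{n\ge0}\Phi_n$, where $\Phi_n$ is an orthonormal basis of the range of $P_n-P_{n-1}$, each element of $\Phi_n$ ($n\ge1$) being supported in a single atom of $\mathscr F_{n-1}$ (so that each element of $\Phi$ is a sum of at most $\nu$ elements of $\mathcal C$). It is assumed that for each $1<p<\infty$ the $L^p$-normalization of $\Phi$ is a greedy basis of $L^p(S)$ (i.e. $\|f-\mathscr G_mf\|_p$ is, up to a uniform constant, the best $m$-term approximation error, where $\mathscr G_m f$ is the sum of the $m$ terms of the basis expansion of $f$ with largest coefficients in absolute value) satisfying the $p$-Temlyakov property: $\|\sum_{n\in\Lambda}\psi_n\|_p\simeq(\operatorname{card}\Lambda)^{1/p}$ uniformly over finite index sets $\Lambda$, $(\psi_n)$ being the normalized system. Approximation space: for a linearly dense subset $\mathcal D\subset L^p(S)$, $\Sigma_n^{\mathcal D}$ is the set of linear combinations of $n$ elements of $\mathcal D$, $\sigma_n(f,\mathcal D)=\inf\{\|f-g\|_p:g\in\Sigma_n^{\mathcal D}\}$, and $\mathcal A_q^\alpha(L^p(S),\mathcal D)=\{f\in L^p(S):\|f\|_p+\|(2^{n\alpha}\sigma_{2^n}(f,\mathcal D))_{n\ge0}\|_{\ell^q}<\infty\}$ with this expression as quasi-norm. Variation space: $E_p(f,R)=\inf\{\|f-g\|_{L^p(R)}:g\in S_R\}$, $|f|_{V_{\sigma,p}}=\sup_\Pi\big(\sum_{R\in\Pi}E_p(f,R)^\sigma\big)^{1/\sigma}$,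 supremum over all finite collections $\Pi$ of pairwise disjoint atoms or rings; $V_{\sigma,p}=\{f\in L^p(S):\|f\|_{V_{\sigma,p}}:=\|f\|_p+|f|_{V_{\sigma,p}}<\infty\}$. *)

theory Defs
  imports "HOL-Probability.Probability" "HOL-Library.Function_Algebras"
begin

text \<open>
  Scalars are of class \<open>{real_normed_field, euclidean_space}\<close>, which has both \<open>real\<close> and
  \<open>complex\<close> as instances, so that everything below covers real and complex scalars uniformly.
  Elements of \<open>L\<^sup>p\<close> are represented by measurable functions; two functions that agree almost
  everywhere represent the same element.
\<close>

global_interpretation fun_space: vector_space "\<lambda>(c::'k::field) (f::'a \<Rightarrow> 'k). (\<lambda>x. c * f x)"
  by unfold_locales (auto simp: fun_eq_iff algebra_simps)

text \<open>The conjugate, expressed through the inner product as \<open>2 Re z - z\<close>.\<close>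

definition conj_scalar :: "'k::{real_normed_field, euclidean_space} \<Rightarrow> 'k" where
  "conj_scalar z = of_real (2 * (z \<bullet> 1)) - z"

lemma conj_scalar_real: "conj_scalar (x::real) = x"
  by (simp add: conj_scalar_def)

lemma conj_scalar_complex: "conj_scalar (z::complex) = cnj z"
  by (simp add: conj_scalar_def complex_eq_iff)


section \<open>Spaces of \<open>p\<close>-integrable functions\<close>

definition Lp_space :: "'a measure \<Rightarrow> real \<Rightarrow> ('a \<Rightarrow> 'k::{real_normed_field, euclidean_space}) set" where
  "Lp_space M p = {f \<in> borel_measurable M. integrable M (\<lambda>x. norm (f x) powr p)}"

definition Lp_norm :: "'a measure \<Rightarrow> real \<Rightarrow> ('a \<Rightarrow> 'k::{real_normed_field, euclidean_space}) \<Rightarrow> real" where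
  "Lp_norm M p f = (\<integral>x. norm (f x) powr p \<partial>M) powr (1 / p)"

definition Lp_closure ::
    "'a measure \<Rightarrow> real \<Rightarrow> ('a \<Rightarrow> 'k::{real_normed_field, euclidean_space}) set \<Rightarrow> ('a \<Rightarrow> 'k) set" where
  "Lp_closure M p V = {f \<in> Lp_space M p. \<forall>\<epsilon>>0. \<exists>g\<in>V. Lp_norm M p (f - g) < \<epsilon>}"

definition Linf_norm_on ::
    "'a measure \<Rightarrow> 'a set \<Rightarrow> ('a \<Rightarrow> 'k::{real_normed_field, euclidean_space}) \<Rightarrow> real" where
  "Linf_norm_on M A f = real_of_ereal (esssup (restrict_space M A) (\<lambda>x. ereal (norm (f x))))"

definition L2_inner ::
    "'a measure \<Rightarrow> ('a \<Rightarrow> 'k::{real_normed_field, euclidean_space}) \<Rightarrow> ('a \<Rightarrow> 'k) \<Rightarrow> 'k" where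
  "L2_inner M f g = (\<integral>x. f x * conj_scalar (g x) \<partial>M)"

text \<open>\<open>u\<close> is (a representative of) the orthogonal projection of \<open>f\<close> onto the subspace \<open>V\<close>.\<close>

definition is_orth_proj ::
    "'a measure \<Rightarrow> ('a \<Rightarrow> 'k::{real_normed_field, euclidean_space}) set \<Rightarrow> ('a \<Rightarrow> 'k) \<Rightarrow> ('a \<Rightarrow> 'k) \<Rightarrow> bool" where
  "is_orth_proj M V f u \<longleftrightarrow> u \<in> V \<and> (\<forall>v\<in>V. L2_inner M (f - u) v = 0)"

definition is_orthonormal_basis ::
    "'a measure \<Rightarrow> ('a \<Rightarrow> 'k::{real_normed_field, euclidean_space}) set \<Rightarrow> ('a \<Rightarrow> 'k) set \<Rightarrow> bool" where
  "is_orthonormal_basis M B W \<longleftrightarrow>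
     B \<subseteq> W \<and>
     (\<forall>\<phi>\<in>B. \<forall>\<psi>\<in>B. L2_inner M \<phi> \<psi> = (if \<phi> = \<psi> then 1 else 0)) \<and>
     (\<forall>w\<in>W. \<exists>g\<in>fun_space.span B. AE x in M. w x = g x)"


section \<open>Atoms and rings\<close>

definition sigma_atoms :: "'a measure \<Rightarrow> 'a set set" where
  "sigma_atoms G = {A \<in> sets G. A \<noteq> {} \<and> (\<forall>B\<in>sets G. B \<subseteq> A \<longrightarrow> B = {} \<or> B = A)}"

definition filt_atoms :: "(nat \<Rightarrow> 'a measure) \<Rightarrow> 'a set set" where
  "filt_atoms F = (\<Union>n. sigma_atoms (F n))"

definition filt_rings :: "(nat \<Rightarrow> 'a measure) \<Rightarrow> 'a set set" where
  "filt_rings F = {A - B | A B. A \<in> filt_atoms F \<and> B \<in> filt_atoms F \<and> B \<subset> A}"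

locale nary_filtration =
  prob_space M + filtration "space M" F
  for M :: "'a measure" and F :: "nat \<Rightarrow> 'a measure" +
  fixes \<nu> :: nat
  assumes nu_ge_2: "\<nu> \<ge> 2"
    and subalg: "subalgebra M (F n)"
    and finite_sets: "finite (sets (F n))"
    and sets_F_0: "sets (F 0) = {{}, space M}"
    and nary: "A \<in> sigma_atoms (F n) \<Longrightarrow>
      \<exists>\<B> \<subseteq> sigma_atoms (F (Suc n)). card \<B> \<le> \<nu> \<and> A = \<Union>\<B>"
    and atoms_pos: "A \<in> sigma_atoms (F n) \<Longrightarrow> measure M A > 0"


section \<open>Local spaces and local orthonormal systems\<close>

definition cut :: "('a \<Rightarrow> 'k::field) \<Rightarrow> 'a set \<Rightarrow> 'a \<Rightarrow> 'k" where
  "cut f R = (\<lambda>x. f x * indicator R x)"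

definition LpS :: "'a measure \<Rightarrow> (nat \<Rightarrow> 'a measure) \<Rightarrow>
    ('a \<Rightarrow> 'k::{real_normed_field, euclidean_space}) set \<Rightarrow> real \<Rightarrow> ('a \<Rightarrow> 'k) set" where
  "LpS M F S p = Lp_closure M p (fun_space.span {cut f A | f A. f \<in> S \<and> A \<in> filt_atoms F})"

definition piecewise_S :: "(nat \<Rightarrow> 'a measure) \<Rightarrow> ('a \<Rightarrow> 'k::field) set \<Rightarrow> nat \<Rightarrow> ('a \<Rightarrow> 'k) set" where
  "piecewise_S F S n = {f. \<forall>A\<in>sigma_atoms (F n). \<exists>g\<in>S. \<forall>x\<in>A. f x = g x}"

text \<open>
  The range of \<open>P\<^sub>n - P\<^sub>n\<^sub>-\<^sub>1\<close> (with \<open>P\<^sub>-\<^sub>1 = 0\<close>), where \<open>P\<^sub>n\<close> is the orthogonal projection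
  onto \<^term>\<open>piecewise_S F S n\<close>. It is closed under passing to another representative.
\<close>

definition proj_increment_range :: "'a measure \<Rightarrow> (nat \<Rightarrow> 'a measure) \<Rightarrow>
    ('a \<Rightarrow> 'k::{real_normed_field, euclidean_space}) set \<Rightarrow> nat \<Rightarrow> ('a \<Rightarrow> 'k) set" where
  "proj_increment_range M F S n =
     {w \<in> Lp_space M 2. \<exists>f \<in> Lp_space M 2. \<exists>u v.
        is_orth_proj M (piecewise_S F S n) f u \<and>
        (case n of 0 \<Rightarrow> v = 0 | Suc m \<Rightarrow> is_orth_proj M (piecewise_S F S m) f v) \<and>
        (AE x in M. w x = u x - v x)}"


section \<open>Approximation and greedy bases\<close>

text \<open>
  Linear combinations of at most \<open>n\<close> elements of \<open>D\<close>; if \<open>D\<close> has at least \<open>n\<close> elements these are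
  the same as linear combinations of exactly \<open>n\<close> elements, since coefficients may vanish.
\<close>

definition n_term :: "('a \<Rightarrow> 'k::field) set \<Rightarrow> nat \<Rightarrow> ('a \<Rightarrow> 'k) set" where
  "n_term D n = {(\<lambda>x. \<Sum>g\<in>T. c g * g x) | c T. T \<subseteq> D \<and> finite T \<and> card T \<le> n}"

definition best_n_term_error :: "'a measure \<Rightarrow> real \<Rightarrow>
    ('a \<Rightarrow> 'k::{real_normed_field, euclidean_space}) set \<Rightarrow> nat \<Rightarrow> ('a \<Rightarrow> 'k) \<Rightarrow> real" where
  "best_n_term_error M p D n f = (INF g\<in>n_term D n. Lp_norm M p (f - g))"

text \<open>
  Bases may be finite or countably infinite, so they are indexed by an initial segment \<open>I\<close> of
  the natural numbers. Coefficient sequences are extended by \<open>0\<close> outside of \<open>I\<close>.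
\<close>

definition is_expansion :: "'a measure \<Rightarrow> real \<Rightarrow> nat set \<Rightarrow>
    (nat \<Rightarrow> 'a \<Rightarrow> 'k::{real_normed_field, euclidean_space}) \<Rightarrow> ('a \<Rightarrow> 'k) \<Rightarrow> (nat \<Rightarrow> 'k) \<Rightarrow> bool" where
  "is_expansion M p I e f c \<longleftrightarrow>
     (\<forall>i. i \<notin> I \<longrightarrow> c i = 0) \<and>
     (\<lambda>n. Lp_norm M p (\<lambda>x. f x - (\<Sum>i<n. c i * e i x))) \<longlonglongrightarrow> 0"

definition is_schauder_basis :: "'a measure \<Rightarrow> real \<Rightarrow> ('a \<Rightarrow> 'k) set \<Rightarrow> nat set \<Rightarrow>
    (nat \<Rightarrow> 'a \<Rightarrow> 'k::{real_normed_field, euclidean_space}) \<Rightarrow> bool" where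
  "is_schauder_basis M p X I e \<longleftrightarrow>
     (I = UNIV \<or> (\<exists>N. I = {..<N})) \<and> e ` I \<subseteq> X \<and>
     (\<forall>f\<in>X. \<exists>!c. is_expansion M p I e f c)"

text \<open>
  \<open>\<Lambda>\<close> is a set of \<open>m\<close> indices carrying the largest coefficients in absolute value. In case of
  ties there may be several; the greedy inequality is required for each of them.
\<close>

definition is_greedy_set :: "nat set \<Rightarrow> (nat \<Rightarrow> 'k::real_normed_field) \<Rightarrow> nat \<Rightarrow> nat set \<Rightarrow> bool" where
  "is_greedy_set I c m \<Lambda> \<longleftrightarrow>
     \<Lambda> \<subseteq> I \<and> finite \<Lambda> \<and> card \<Lambda> = m \<and> (\<forall>i\<in>\<Lambda>. \<forall>j\<in>I - \<Lambda>. norm (c j) \<le> norm (c i))"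

definition is_greedy_basis :: "'a measure \<Rightarrow> real \<Rightarrow> ('a \<Rightarrow> 'k) set \<Rightarrow>
    ('a \<Rightarrow> 'k::{real_normed_field, euclidean_space}) set \<Rightarrow> bool" where
  "is_greedy_basis M p X \<Psi> \<longleftrightarrow>
     (\<exists>I e. bij_betw e I \<Psi> \<and> is_schauder_basis M p X I e \<and>
        (\<exists>C. \<forall>f\<in>X. \<forall>c m \<Lambda>. is_expansion M p I e f c \<longrightarrow> is_greedy_set I c m \<Lambda> \<longrightarrow>
           Lp_norm M p (\<lambda>x. f x - (\<Sum>i\<in>\<Lambda>. c i * e i x)) \<le> C * best_n_term_error M p \<Psi> m f))"

definition temlyakov_property :: "'a measure \<Rightarrow> real \<Rightarrow>
    ('a \<Rightarrow> 'k::{real_normed_field, euclidean_space}) set \<Rightarrow> bool" where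
  "temlyakov_property M p \<Psi> \<longleftrightarrow>
     (\<exists>c>0. \<exists>C. \<forall>\<Lambda>\<subseteq>\<Psi>. finite \<Lambda> \<longrightarrow>
        c * real (card \<Lambda>) powr (1 / p) \<le> Lp_norm M p (\<lambda>x. \<Sum>\<psi>\<in>\<Lambda>. \<psi> x) \<and>
        Lp_norm M p (\<lambda>x. \<Sum>\<psi>\<in>\<Lambda>. \<psi> x) \<le> C * real (card \<Lambda>) powr (1 / p))"

definition Lp_normalize :: "'a measure \<Rightarrow> real \<Rightarrow>
    ('a \<Rightarrow> 'k::{real_normed_field, euclidean_space}) \<Rightarrow> 'a \<Rightarrow> 'k" where
  "Lp_normalize M p \<phi> = (\<lambda>x. \<phi> x /\<^sub>R Lp_norm M p \<phi>)"

locale local_orthonormal_system = nary_filtration M F \<nu>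
  for M :: "'a measure" and F :: "nat \<Rightarrow> 'a measure" and \<nu> :: nat +
  fixes S :: "('a \<Rightarrow> 'k::{real_normed_field, euclidean_space}) set"
    and \<Phi> :: "nat \<Rightarrow> ('a \<Rightarrow> 'k) set"
  assumes S_finite_dim: "\<exists>B. finite B \<and> S = fun_space.span B"
    and S_measurable: "f \<in> S \<Longrightarrow> f \<in> borel_measurable M"
    and S_bounded: "f \<in> S \<Longrightarrow> bounded (f ` space M)"
    and S_large_on_atoms: "\<exists>c1\<in>{0<..1}. \<exists>c2\<in>{0<..1}. \<forall>A\<in>filt_atoms F. \<forall>f\<in>S.
      c2 * measure M A \<le> measure M {x \<in> A. c1 * Linf_norm_on M A f \<le> norm (f x)}"
    and Phi_orthonormal_basis: "is_orthonormal_basis M (\<Phi> n) (proj_increment_range M F S n)"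
    and Phi_local: "\<phi> \<in> \<Phi> (Suc n) \<Longrightarrow>
      \<exists>A\<in>sigma_atoms (F n). AE x in M. x \<notin> A \<longrightarrow> \<phi> x = 0"
    and Phi_greedy: "1 < p \<Longrightarrow> is_greedy_basis M p (LpS M F S p) (Lp_normalize M p ` (\<Union>n. \<Phi> n))"
    and Phi_temlyakov: "1 < p \<Longrightarrow> temlyakov_property M p (Lp_normalize M p ` (\<Union>n. \<Phi> n))"


section \<open>Approximation spaces and variation spaces\<close>

text \<open>Quasi-norms take values in \<^typ>\<open>ennreal\<close>; the spaces consist of the functions where they are finite.\<close>

definition lq_norm :: "real \<Rightarrow> (nat \<Rightarrow> real) \<Rightarrow> ennreal" where
  "lq_norm q a =
     (if summable (\<lambda>n. \<bar>a n\<bar> powr q) then ennreal ((\<Sum>n. \<bar>a n\<bar> powr q) powr (1 / q)) else \<infinity>)"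

definition approx_norm :: "'a measure \<Rightarrow> real \<Rightarrow> ('a \<Rightarrow> 'k) set \<Rightarrow> real \<Rightarrow> real \<Rightarrow>
    ('a \<Rightarrow> 'k::{real_normed_field, euclidean_space}) \<Rightarrow> ennreal" where
  "approx_norm M p D \<alpha> q f =
     ennreal (Lp_norm M p f) +
     lq_norm q (\<lambda>n. 2 powr (real n * \<alpha>) * best_n_term_error M p D (2 ^ n) f)"

definition approx_space :: "'a measure \<Rightarrow> real \<Rightarrow> ('a \<Rightarrow> 'k) set \<Rightarrow> ('a \<Rightarrow> 'k) set \<Rightarrow> real \<Rightarrow> real \<Rightarrow>
    ('a \<Rightarrow> 'k::{real_normed_field, euclidean_space}) set" where
  "approx_space M p X D \<alpha> q = {f \<in> X. approx_norm M p D \<alpha> q f < \<infinity>}"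

definition local_error :: "'a measure \<Rightarrow> ('a \<Rightarrow> 'k) set \<Rightarrow> real \<Rightarrow>
    ('a \<Rightarrow> 'k::{real_normed_field, euclidean_space}) \<Rightarrow> 'a set \<Rightarrow> real" where
  "local_error M S p f R = (INF g\<in>(\<lambda>h. cut h R) ` S. Lp_norm (restrict_space M R) p (f - g))"

definition variation :: "'a measure \<Rightarrow> (nat \<Rightarrow> 'a measure) \<Rightarrow> ('a \<Rightarrow> 'k) set \<Rightarrow> real \<Rightarrow> real \<Rightarrow>
    ('a \<Rightarrow> 'k::{real_normed_field, euclidean_space}) \<Rightarrow> ennreal" where
  "variation M F S \<sigma> p f =
     (SUP \<P>\<in>{\<P>. finite \<P> \<and> \<P> \<subseteq> filt_atoms F \<union> filt_rings F \<and> disjoint \<P>}.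
        ennreal ((\<Sum>R\<in>\<P>. local_error M S p f R powr \<sigma>) powr (1 / \<sigma>)))"

definition variation_norm :: "'a measure \<Rightarrow> (nat \<Rightarrow> 'a measure) \<Rightarrow> ('a \<Rightarrow> 'k) set \<Rightarrow> real \<Rightarrow> real \<Rightarrow>
    ('a \<Rightarrow> 'k::{real_normed_field, euclidean_space}) \<Rightarrow> ennreal" where
  "variation_norm M F S \<sigma> p f = ennreal (Lp_norm M p f) + variation M F S \<sigma> p f"

definition variation_space :: "'a measure \<Rightarrow> (nat \<Rightarrow> 'a measure) \<Rightarrow> ('a \<Rightarrow> 'k) set \<Rightarrow> real \<Rightarrow> real \<Rightarrow>
    ('a \<Rightarrow> 'k::{real_normed_field, euclidean_space}) set" where
  "variation_space M F S \<sigma> p = {f \<in> LpS M F S p. variation_norm M F S \<sigma> p f < \<infinity>}"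

definition embeds_continuously :: "'b set \<Rightarrow> ('b \<Rightarrow> ennreal) \<Rightarrow> 'b set \<Rightarrow> ('b \<Rightarrow> ennreal) \<Rightarrow> bool" where
  "embeds_continuously X NX Y NY \<longleftrightarrow> X \<subseteq> Y \<and> (\<exists>C::real. \<forall>f\<in>X. NY f \<le> ennreal C * NX f)"

end

theory Submission
  imports Defs
begin

text \<open>
  The variation of \<open>f\<close> is controlled by the \<open>\<ell>\<^sup>\<sigma>\<close>-norm of its coefficients \<open>c\<close> in the
  \<open>p\<close>-normalized system, and so is, from the other side, the approximation norm. Two facts
  about the system and one about atoms and rings carry the proof.

  Coefficients bound norms (lemma \<open>ell_sigma_upper\<close>). Let \<open>A\<close>, \<open>B\<close> be disjoint sets of indices,
  \<open>A\<close> having no more elements than \<open>B\<close>, and let all coefficients on \<open>B\<close> dominate those on \<open>A\<close>.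
  The greedy algorithm applied to the sum of the two combinations may remove the \<open>B\<close>-part, while
  removing the \<open>A\<close>-part is a competing approximation; hence the \<open>A\<close>-part is bounded by the
  \<open>B\<close>-part (lemma \<open>comparison\<close>). With constant coefficients on \<open>B\<close> and the Temlyakov property,
  a combination of \<open>m\<close> terms with coefficients at most \<open>t\<close> has norm at most a constant times
  \<open>t m\<^sup>1\<^sup>/\<^sup>p\<close>. Splitting the coefficients into dyadic levels gives geometric decay because
  \<open>\<sigma> < p\<close>, so that the \<open>L\<^sup>p\<close>-norm is bounded by the \<open>\<ell>\<^sup>\<sigma>\<close>-norm of the coefficients.

  Approximation errors bound coefficients (lemma \<open>coefficients_ell_sigma\<close>). If \<open>2k\<close> coefficients
  are at least \<open>t\<close> in absolute value, then after subtracting any \<open>k\<close>-term approximant at least \<open>k\<close>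
  of them survive untouched. Greedy bases have bounded coordinate projections, so the error is at
  least a constant times the norm of the combination of these \<open>k\<close> terms; by \<open>comparison\<close> with the
  other \<open>k\<close> indices this is at least a constant times \<open>t k\<^sup>1\<^sup>/\<^sup>p\<close>. Summing over \<open>k = 2\<^sup>n\<close> with
  \<open>\<alpha> = 1/\<sigma> - 1/p\<close> bounds the \<open>\<ell>\<^sup>\<sigma>\<close>-norm of the coefficients by the approximation norm with
  exponent \<open>\<sigma>\<close>, and hence by the one with any exponent \<open>q \<le> \<sigma>\<close>.

  Locality (lemmas \<open>Phi_local_structure\<close> and \<open>card_crossing_le_2\<close>). An element of the system
  that belongs to an atom \<open>C\<close> agrees with an element of \<open>S\<close> on every atom or ring \<open>R\<close>, unless \<open>R\<close>
  contains all of \<open>C\<close>, or all of \<open>C\<close> but a smaller atom. In a disjoint family this exception occurs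
  at most twice. The local error of \<open>f\<close> on \<open>R\<close> is therefore at most the norm of the sum of the
  exceptional terms for \<open>R\<close>, and in the sum of the \<open>\<sigma>\<close>-th powers of these norms over the family
  each coefficient is counted at most twice.
\<close>

section \<open>The space of \<open>p\<close>-integrable functions\<close>

lemma Lp_norm_nonneg: "0 \<le> Lp_norm M p f"
  by (simp add: Lp_norm_def)

lemma Lp_norm_cong_AE:
  assumes "f \<in> borel_measurable M" "g \<in> borel_measurable M" "AE x in M. f x = g x"
  shows "Lp_norm M p f = Lp_norm M p g"
proof -
  have "(\<integral>x. norm (f x) powr p \<partial>M) = (\<integral>x. norm (g x) powr p \<partial>M)"
    using assms by (intro integral_cong_AE) auto
  then show ?thesis by (simp add: Lp_norm_def)
qed

lemma Lp_norm_zero: "Lp_norm M p (\<lambda>x. 0) = 0"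
  by (simp add: Lp_norm_def)

lemma Lp_norm_cmult:
  assumes "p > 0"
  shows "Lp_norm M p (\<lambda>x. c * f x) = norm c * Lp_norm M p f"
proof -
  have "(\<integral>x. norm (c * f x) powr p \<partial>M) = norm c powr p * (\<integral>x. norm (f x) powr p \<partial>M)"
    by (simp add: norm_mult powr_mult)
  then show ?thesis
    using assms by (simp add: Lp_norm_def powr_mult powr_powr)
qed

lemma Lp_norm_powr:
  assumes "p > 0"
  shows "Lp_norm M p f powr p = (\<integral>x. norm (f x) powr p \<partial>M)"
  using assms by (simp add: Lp_norm_def powr_powr)

lemma Lp_space_measurable: "f \<in> Lp_space M p \<Longrightarrow> f \<in> borel_measurable M"
  by (simp add: Lp_space_def)

lemma Lp_space_zero: "(\<lambda>x. 0) \<in> Lp_space M p"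
  by (simp add: Lp_space_def)

lemma Lp_space_cmult:
  "f \<in> Lp_space M p \<Longrightarrow> (\<lambda>x. c * f x) \<in> Lp_space M p"
  by (auto simp: Lp_space_def norm_mult powr_mult)

lemma Lp_norm_zero_imp_AE:
  assumes "f \<in> Lp_space M p" "Lp_norm M p f = 0" "p > 0"
  shows "AE x in M. f x = 0"
proof -
  have "(\<integral>x. norm (f x) powr p \<partial>M) = 0"
    using Lp_norm_powr[of p M f] assms by simp
  then have "AE x in M. norm (f x) powr p = 0"
    using assms integral_nonneg_eq_0_iff_AE[of M "\<lambda>x. norm (f x) powr p"] by (simp add: Lp_space_def)
  then show ?thesis by (rule AE_mp) auto
qed

text \<open>
  The library convexity of \<open>x \<mapsto> x powr p\<close> is for positive arguments; at \<open>0\<close> it reduces to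
  \<open>t powr p \<le> t\<close>.
\<close>

lemma powr_convex_combination:
  fixes x y t p :: real
  assumes "1 \<le> p" "0 \<le> x" "0 \<le> y" "0 < t" "t < 1"
  shows "(t * x + (1 - t) * y) powr p \<le> t * x powr p + (1 - t) * y powr p"
proof -
  have scaled: "(s * z) powr p \<le> s * z powr p" if "0 < s" "s < 1" "0 \<le> z" for s z :: real
  proof -
    have "s powr p \<le> s powr 1" using that assms by (intro powr_mono') auto
    then show ?thesis using that by (simp add: powr_mult mult_right_mono)
  qed
  show ?thesis
  proof (cases "x = 0 \<or> y = 0")
    case True
    then show ?thesis using scaled[of t x] scaled[of "1 - t" y] assms by auto
  next
    case False
    then show ?thesis
      using convex_onD[OF powr_convex[OF assms(1)], of "1 - t" x y] assms by auto
  qed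
qed

text \<open>
  The pointwise form of the triangle inequality: \<open>(u + v) / (a + b)\<close> is a convex combination of
  \<open>u / a\<close> and \<open>v / b\<close>. For \<open>a\<close>, \<open>b\<close> the norms of two functions it integrates to the triangle
  inequality in \<open>L\<^sup>p\<close>.
\<close>

lemma norm_add_powr_le:
  fixes u v :: "'k::real_normed_vector"
  assumes "1 \<le> p" "0 < a" "0 < b"
  shows "norm (u + v) powr p \<le> (a + b) powr p *
    (a / (a + b) * (norm u powr p / a powr p) + b / (a + b) * (norm v powr p / b powr p))"
proof -
  let ?t = "a / (a + b)"
  have t: "0 < ?t" "?t < 1" and t': "1 - ?t = b / (a + b)"
    using assms by (auto simp: field_simps)
  have "(a + b) * (?t * (norm u / a)) = norm u" "(a + b) * ((1 - ?t) * (norm v / b)) = norm v"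
    using assms unfolding t' by simp_all
  then have "norm (u + v) \<le> (a + b) * (?t * (norm u / a) + (1 - ?t) * (norm v / b))"
    using norm_triangle_ineq[of u v] by (simp only: distrib_left)
  then have "norm (u + v) powr p \<le> ((a + b) * (?t * (norm u / a) + (1 - ?t) * (norm v / b))) powr p"
    using assms(1) by (intro powr_mono2) auto
  also have "\<dots> = (a + b) powr p * (?t * (norm u / a) + (1 - ?t) * (norm v / b)) powr p"
    using assms(1) by (intro powr_mult)
  also have "\<dots> \<le> (a + b) powr p * (?t * (norm u / a) powr p + (1 - ?t) * (norm v / b) powr p)"
    using assms by (intro mult_left_mono powr_convex_combination t divide_nonneg_pos) simp_all
  finally show ?thesis
    using assms by (simp add: t' powr_divide)
qed

lemma Lp_space_add:
  assumes "1 \<le> p" "f \<in> Lp_space M p" "g \<in> Lp_space M p"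
  shows "(\<lambda>x. f x + g x) \<in> Lp_space M p"
proof -
  have "integrable M (\<lambda>x. norm (f x + g x) powr p)"
  proof (rule Bochner_Integration.integrable_bound)
    show "integrable M (\<lambda>x. 2 powr p * (1/2 * norm (f x) powr p + 1/2 * norm (g x) powr p))"
      using assms by (auto simp: Lp_space_def)
    show "AE x in M. norm (norm (f x + g x) powr p)
        \<le> norm (2 powr p * (1/2 * norm (f x) powr p + 1/2 * norm (g x) powr p))"
      using norm_add_powr_le[OF assms(1), of 1 1] by (intro AE_I2) auto
  qed (use assms in \<open>auto simp: Lp_space_def\<close>)
  then show ?thesis using assms by (auto simp: Lp_space_def)
qed

lemma Lp_norm_triangle:
  assumes p: "1 \<le> p" and f: "f \<in> Lp_space M p" and g: "g \<in> Lp_space M p"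
  shows "Lp_norm M p (\<lambda>x. f x + g x) \<le> Lp_norm M p f + Lp_norm M p g"
proof -
  define a b where "a = Lp_norm M p f" and "b = Lp_norm M p g"
  have [measurable]: "f \<in> borel_measurable M" "g \<in> borel_measurable M"
    using f g by (auto simp: Lp_space_def)
  consider "a = 0" | "b = 0" | "a > 0" "b > 0"
    using Lp_norm_nonneg[of M p f] Lp_norm_nonneg[of M p g] unfolding a_def b_def by fastforce
  then show ?thesis
  proof cases
    case 1
    then have "AE x in M. f x = 0" using Lp_norm_zero_imp_AE f p by (force simp: a_def)
    then have "Lp_norm M p (\<lambda>x. f x + g x) = Lp_norm M p g"
      by (intro Lp_norm_cong_AE) auto
    then show ?thesis by (simp add: Lp_norm_nonneg)
  next
    case 2
    then have "AE x in M. g x = 0" using Lp_norm_zero_imp_AE g p by (force simp: b_def)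
    then have "Lp_norm M p (\<lambda>x. f x + g x) = Lp_norm M p f"
      by (intro Lp_norm_cong_AE) auto
    then show ?thesis by (simp add: Lp_norm_nonneg)
  next
    case 3
    have "(\<integral>x. norm (f x + g x) powr p \<partial>M) \<le> (\<integral>x. (a + b) powr p *
      (a / (a + b) * (norm (f x) powr p / a powr p) + b / (a + b) * (norm (g x) powr p / b powr p)) \<partial>M)"
      using Lp_space_add[OF p f g] f g norm_add_powr_le[OF p 3]
      by (intro integral_mono) (auto simp: Lp_space_def)
    also have "\<dots> = (a + b) powr p * (a / (a + b) * (a powr p / a powr p) + b / (a + b) * (b powr p / b powr p))"
      using f g p by (simp add: Lp_space_def Lp_norm_powr a_def b_def)
    also have "\<dots> = (a + b) powr p"
      using 3 by (simp add: add_divide_distrib[symmetric])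
    finally have "(\<integral>x. norm (f x + g x) powr p \<partial>M) powr (1 / p) \<le> ((a + b) powr p) powr (1 / p)"
      using p by (intro powr_mono2) auto
    also have "\<dots> = a + b" using 3 p by (simp add: powr_powr)
    finally show ?thesis by (simp add: Lp_norm_def a_def b_def)
  qed
qed

lemma Lp_norm_uminus: "Lp_norm M p (\<lambda>x. - f x) = Lp_norm M p f"
  by (simp add: Lp_norm_def)

lemma Lp_norm_triangle_diff:
  assumes "1 \<le> p" "f \<in> Lp_space M p" "g \<in> Lp_space M p"
  shows "Lp_norm M p (\<lambda>x. f x - g x) \<le> Lp_norm M p f + Lp_norm M p g"
  using Lp_norm_triangle[OF assms(1,2) Lp_space_cmult[OF assms(3), of "-1"]]
  by (simp add: Lp_norm_uminus)

lemma Lp_space_subspace: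
  assumes "1 \<le> p"
  shows "fun_space.subspace (Lp_space M p)"
  unfolding fun_space.subspace_def
  using assms Lp_space_zero Lp_space_add Lp_space_cmult
  by (auto simp: zero_fun_def plus_fun_def)

text \<open>
  The inclusion of \<open>V\<close> in \<open>L\<^sup>p\<close> matters because the Bochner integral of a non-integrable function
  is \<open>0\<close>, so that the triangle inequality fails outside of \<open>L\<^sup>p\<close>.
\<close>

lemma Lp_closure_subspace:
  assumes p: "1 \<le> p" and V: "fun_space.subspace V" "V \<subseteq> Lp_space M p"
  shows "fun_space.subspace (Lp_closure M p V)"
  unfolding fun_space.subspace_def
proof (intro conjI ballI allI)
  note Lp_add = fun_space.subspace_add[OF Lp_space_subspace[OF p]]
    and Lp_diff = fun_space.subspace_diff[OF Lp_space_subspace[OF p]]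
  have "\<exists>g\<in>V. Lp_norm M p (0 - g) < \<epsilon>" if "\<epsilon> > 0" for \<epsilon>
    using fun_space.subspace_0[OF V(1)] that
    by (intro bexI[of _ 0]) (simp_all add: zero_fun_def fun_diff_def Lp_norm_zero)
  then show "0 \<in> Lp_closure M p V"
    using fun_space.subspace_0[OF Lp_space_subspace[OF p]] by (simp add: Lp_closure_def)
  fix f g assume f: "f \<in> Lp_closure M p V" and g: "g \<in> Lp_closure M p V"
  show "f + g \<in> Lp_closure M p V"
    unfolding Lp_closure_def
  proof (intro CollectI conjI allI impI)
    have fg: "f \<in> Lp_space M p" "g \<in> Lp_space M p" using f g by (simp_all add: Lp_closure_def)
    then show "f + g \<in> Lp_space M p" by (rule Lp_add)
    fix \<epsilon> :: real assume "\<epsilon> > 0"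
    then have "\<epsilon> / 2 > 0" by simp
    then obtain u v where u: "u \<in> V" "Lp_norm M p (f - u) < \<epsilon> / 2"
      and v: "v \<in> V" "Lp_norm M p (g - v) < \<epsilon> / 2"
      using f g unfolding Lp_closure_def by blast
    have "f + g - (u + v) = (\<lambda>x. (f - u) x + (g - v) x)" by (auto simp: fun_eq_iff)
    then have "Lp_norm M p (f + g - (u + v)) \<le> Lp_norm M p (f - u) + Lp_norm M p (g - v)"
      using Lp_norm_triangle[OF p Lp_diff Lp_diff, OF fg(1) _ fg(2)] u(1) v(1) V(2) by auto
    then show "\<exists>w\<in>V. Lp_norm M p (f + g - w) < \<epsilon>"
      using u v fun_space.subspace_add[OF V(1)] by (intro bexI[of _ "u + v"]) auto
  qed
next
  fix c f assume f: "f \<in> Lp_closure M p V"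
  show "(\<lambda>x. c * f x) \<in> Lp_closure M p V"
    unfolding Lp_closure_def
  proof (intro CollectI conjI allI impI)
    show "(\<lambda>x. c * f x) \<in> Lp_space M p" using f Lp_space_cmult by (auto simp: Lp_closure_def)
    fix \<epsilon> :: real assume "\<epsilon> > 0"
    then have "\<epsilon> / (norm c + 1) > 0" by (simp add: add_nonneg_pos)
    then obtain u where u: "u \<in> V" "Lp_norm M p (f - u) < \<epsilon> / (norm c + 1)"
      using f unfolding Lp_closure_def by blast
    have "Lp_norm M p ((\<lambda>x. c * f x) - (\<lambda>x. c * u x)) = Lp_norm M p (\<lambda>x. c * (f - u) x)"
      by (simp add: fun_diff_def algebra_simps)
    also have "\<dots> = norm c * Lp_norm M p (f - u)" using p by (intro Lp_norm_cmult) auto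
    also have "\<dots> \<le> (norm c + 1) * Lp_norm M p (f - u)"
      by (intro mult_right_mono) (auto simp: Lp_norm_nonneg)
    also have "\<dots> < \<epsilon>" using u(2) pos_less_divide_eq[of "norm c + 1"]
      by (simp add: add_nonneg_pos mult.commute)
    finally show "\<exists>w\<in>V. Lp_norm M p ((\<lambda>x. c * f x) - w) < \<epsilon>"
      using u fun_space.subspace_scale[OF V(1)] by (intro bexI[of _ "\<lambda>x. c * u x"]) auto
  qed
qed

lemma Lp_norm_restrict_le:
  assumes "f \<in> Lp_space M p" "R \<in> sets M" "p > 0"
  shows "Lp_norm (restrict_space M R) p f \<le> Lp_norm M p f"
proof -
  have "(\<integral>x. norm (f x) powr p \<partial>restrict_space M R) = (\<integral>x. indicator R x *\<^sub>R norm (f x) powr p \<partial>M)"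
    using assms by (intro integral_restrict_space) auto
  also have "\<dots> \<le> (\<integral>x. norm (f x) powr p \<partial>M)"
    using assms integrable_mult_indicator[of R M "\<lambda>x. norm (f x) powr p"]
    by (intro integral_mono) (auto simp: Lp_space_def indicator_def)
  finally show ?thesis
    using assms by (simp add: Lp_norm_def powr_mono2)
qed

section \<open>Greedy bases with the Temlyakov property\<close>

lemma n_term_subspace_mem:
  assumes "fun_space.subspace V" "D \<subseteq> V" "g \<in> n_term D n"
  shows "g \<in> V"
proof -
  obtain c T where g: "g = (\<lambda>x. \<Sum>h\<in>T. c h * h x)" and T: "T \<subseteq> D"
    using assms(3) by (auto simp: n_term_def)
  have "g = (\<Sum>h\<in>T. (\<lambda>x. c h * h x))"
    unfolding g by (induction T rule: infinite_finite_induct) (auto simp: fun_eq_iff)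
  then show ?thesis
    using assms(1,2) T
    by (auto intro!: fun_space.subspace_sum fun_space.subspace_scale)
qed

lemma best_n_term_error_nonneg: "0 \<le> best_n_term_error M p D n f"
proof -
  have "(\<lambda>x. 0) \<in> n_term D n"
    by (auto simp: n_term_def intro!: exI[of _ "{}"])
  then show ?thesis
    unfolding best_n_term_error_def by (intro cINF_greatest) (auto simp: Lp_norm_nonneg)
qed

lemma best_n_term_error_le:
  "g \<in> n_term D n \<Longrightarrow> best_n_term_error M p D n f \<le> Lp_norm M p (f - g)"
  unfolding best_n_term_error_def
  by (rule cINF_lower) (auto intro!: bdd_belowI[of _ 0] simp: Lp_norm_nonneg)

lemma le_best_n_term_error:
  assumes "\<And>g. g \<in> n_term D n \<Longrightarrow> b \<le> Lp_norm M p (f - g)"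
  shows "b \<le> best_n_term_error M p D n f"
proof -
  have "(\<lambda>x. 0) \<in> n_term D n"
    by (auto simp: n_term_def intro!: exI[of _ "{}"])
  then show ?thesis
    unfolding best_n_term_error_def using assms by (intro cINF_greatest) auto
qed

text \<open>
  The Temlyakov property is stated in terms of indices, which is the same as for the set of basis
  elements since \<open>e\<close> is injective.
\<close>

locale greedy_Lp_basis =
  fixes M :: "'a measure" and p :: real
    and X :: "('a \<Rightarrow> 'k::{real_normed_field, euclidean_space}) set"
    and I :: "nat set" and e :: "nat \<Rightarrow> 'a \<Rightarrow> 'k" and C lo hi :: real
  assumes p: "1 \<le> p"
    and X_subspace: "fun_space.subspace X" and X_Lp: "X \<subseteq> Lp_space M p"
    and basis: "is_schauder_basis M p X I e" and inj: "inj_on e I"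
    and C: "0 < C"
    and greedy: "f \<in> X \<Longrightarrow> is_expansion M p I e f c \<Longrightarrow> is_greedy_set I c m \<Lambda> \<Longrightarrow>
      Lp_norm M p (\<lambda>x. f x - (\<Sum>i\<in>\<Lambda>. c i * e i x)) \<le> C * best_n_term_error M p (e ` I) m f"
    and lo: "0 < lo" and hi: "0 \<le> hi"
    and lower: "\<Lambda> \<subseteq> I \<Longrightarrow> finite \<Lambda> \<Longrightarrow>
      lo * real (card \<Lambda>) powr (1 / p) \<le> Lp_norm M p (\<lambda>x. \<Sum>i\<in>\<Lambda>. e i x)"
    and upper: "\<Lambda> \<subseteq> I \<Longrightarrow> finite \<Lambda> \<Longrightarrow>
      Lp_norm M p (\<lambda>x. \<Sum>i\<in>\<Lambda>. e i x) \<le> hi * real (card \<Lambda>) powr (1 / p)"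
begin

abbreviation N :: "('a \<Rightarrow> 'k) \<Rightarrow> real" where "N \<equiv> Lp_norm M p"

abbreviation comb :: "(nat \<Rightarrow> 'k) \<Rightarrow> nat set \<Rightarrow> 'a \<Rightarrow> 'k"
  where "comb c \<Lambda> \<equiv> (\<lambda>x. \<Sum>i\<in>\<Lambda>. c i * e i x)"

lemma e_X: "i \<in> I \<Longrightarrow> e i \<in> X"
  using basis by (auto simp: is_schauder_basis_def)

lemma X_add: "f \<in> X \<Longrightarrow> g \<in> X \<Longrightarrow> (\<lambda>x. f x + g x) \<in> X"
  using fun_space.subspace_add[OF X_subspace] by (simp add: plus_fun_def)

lemma X_diff: "f \<in> X \<Longrightarrow> g \<in> X \<Longrightarrow> (\<lambda>x. f x - g x) \<in> X"
  using fun_space.subspace_diff[OF X_subspace] by (simp add: fun_diff_def)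

lemma comb_n_term:
  assumes "\<Lambda> \<subseteq> I" "finite \<Lambda>" "card \<Lambda> \<le> m"
  shows "comb c \<Lambda> \<in> n_term (e ` I) m"
proof -
  have inj': "inj_on e \<Lambda>" using inj assms by (rule_tac inj_on_subset)
  have "comb c \<Lambda> = (\<lambda>x. \<Sum>g\<in>e ` \<Lambda>. c (the_inv_into \<Lambda> e g) * g x)"
    using inj' by (auto simp: fun_eq_iff sum.reindex the_inv_into_f_f)
  moreover have "card (e ` \<Lambda>) \<le> m" using inj' assms by (simp add: card_image)
  ultimately show ?thesis
    using assms unfolding n_term_def
    by (intro CollectI exI[of _ "\<lambda>g. c (the_inv_into \<Lambda> e g)"] exI[of _ "e ` \<Lambda>"]) auto
qed

lemma n_term_comb:
  assumes "g \<in> n_term (e ` I) m"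
  obtains c \<Gamma> where "\<Gamma> \<subseteq> I" "finite \<Gamma>" "card \<Gamma> \<le> m" "g = comb c \<Gamma>"
proof -
  obtain c T where g: "g = (\<lambda>x. \<Sum>h\<in>T. c h * h x)" and T: "T \<subseteq> e ` I" "finite T" "card T \<le> m"
    using assms by (auto simp: n_term_def)
  obtain \<Gamma> where \<Gamma>: "\<Gamma> \<subseteq> I" "finite \<Gamma>" "T = e ` \<Gamma>"
    using finite_subset_image[OF T(2,1)] by auto
  have inj': "inj_on e \<Gamma>" using inj \<Gamma> by (rule_tac inj_on_subset)
  show thesis
    using that[of \<Gamma> "\<lambda>i. c (e i)"] \<Gamma> T inj' by (simp add: g sum.reindex card_image)
qed

lemma comb_X: "\<Lambda> \<subseteq> I \<Longrightarrow> finite \<Lambda> \<Longrightarrow> comb c \<Lambda> \<in> X"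
  using n_term_subspace_mem[OF X_subspace, of "e ` I"] comb_n_term e_X by blast

lemma N_triangle: "f \<in> X \<Longrightarrow> g \<in> X \<Longrightarrow> N (\<lambda>x. f x + g x) \<le> N f + N g"
  using Lp_norm_triangle[OF p] X_Lp by blast

lemma N_triangle_diff: "f \<in> X \<Longrightarrow> g \<in> X \<Longrightarrow> N (\<lambda>x. f x - g x) \<le> N f + N g"
  using Lp_norm_triangle_diff[OF p] X_Lp by blast

lemma N_cmult: "N (\<lambda>x. c * f x) = norm c * N f"
  using p by (intro Lp_norm_cmult) auto

lemma N_comb_const: "N (comb (\<lambda>_. t) \<Lambda>) = norm t * N (\<lambda>x. \<Sum>i\<in>\<Lambda>. e i x)"
  by (simp add: sum_distrib_left[symmetric] N_cmult)

lemma partial_sum_eq: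
  assumes "\<forall>i. i \<notin> I \<longrightarrow> c i = 0"
  shows "(\<lambda>x. \<Sum>i<n. c i * e i x) = comb c ({..<n} \<inter> I)"
  using assms by (auto simp: fun_eq_iff intro!: sum.mono_neutral_right)

text \<open>
  From some index on, the partial sums contain all terms of the finite combination, which then
  cancels from the remainder.
\<close>

lemma expansion_add_comb:
  assumes f: "f \<in> X" "is_expansion M p I e f c" and \<Lambda>: "\<Lambda> \<subseteq> I" "finite \<Lambda>"
  shows "is_expansion M p I e (\<lambda>x. f x + comb b \<Lambda> x) (\<lambda>i. c i + (if i \<in> \<Lambda> then b i else 0))"
  unfolding is_expansion_def
proof (intro conjI)
  show "\<forall>i. i \<notin> I \<longrightarrow> c i + (if i \<in> \<Lambda> then b i else 0) = 0"
    using f \<Lambda> by (auto simp: is_expansion_def)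
  have lim: "(\<lambda>n. N (\<lambda>x. f x - (\<Sum>i<n. c i * e i x))) \<longlonglongrightarrow> 0"
    using f by (simp add: is_expansion_def)
  obtain m where m: "\<Lambda> \<subseteq> {..<m}"
    using \<Lambda>(2) finite_nat_iff_bounded by blast
  have "f x + comb b \<Lambda> x - (\<Sum>i<n. (c i + (if i \<in> \<Lambda> then b i else 0)) * e i x)
      = f x - (\<Sum>i<n. c i * e i x)" if "n \<ge> m" for n x
  proof -
    have "(\<Sum>i<n. (if i \<in> \<Lambda> then b i else 0) * e i x) = comb b \<Lambda> x"
      using m that by (intro sum.mono_neutral_cong_right) auto
    then show ?thesis by (simp add: distrib_right sum.distrib)
  qed
  then have "eventually (\<lambda>n. N (\<lambda>x. f x - (\<Sum>i<n. c i * e i x)) =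
      N (\<lambda>x. f x + comb b \<Lambda> x - (\<Sum>i<n. (c i + (if i \<in> \<Lambda> then b i else 0)) * e i x))) sequentially"
    by (intro eventually_sequentiallyI[of m]) (simp only:)
  then show "(\<lambda>n. N (\<lambda>x. f x + comb b \<Lambda> x - (\<Sum>i<n. (c i + (if i \<in> \<Lambda> then b i else 0)) * e i x)))
      \<longlonglongrightarrow> 0"
    using lim by (rule Lim_transform_eventually[rotated])
qed

lemma expansion_comb:
  assumes "\<Lambda> \<subseteq> I" "finite \<Lambda>"
  shows "is_expansion M p I e (comb b \<Lambda>) (\<lambda>i. if i \<in> \<Lambda> then b i else 0)"
proof -
  have "is_expansion M p I e (\<lambda>x. 0) (\<lambda>i. 0)"
    by (simp add: is_expansion_def Lp_norm_zero)
  moreover have "(\<lambda>x. 0) \<in> X"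
    using fun_space.subspace_0[OF X_subspace] by (simp add: zero_fun_def)
  ultimately show ?thesis using expansion_add_comb[of "\<lambda>x. 0" "\<lambda>i. 0"] assms by simp
qed

text \<open>\<open>\<Lambda>\<close> need only carry the largest coefficients; the competitor is any combination with no
  more terms.\<close>

lemma greedy_le:
  assumes "f \<in> X" "is_expansion M p I e f c" "\<Lambda> \<subseteq> I" "finite \<Lambda>"
    and "\<And>i j. i \<in> \<Lambda> \<Longrightarrow> j \<in> I - \<Lambda> \<Longrightarrow> norm (c j) \<le> norm (c i)"
    and "\<Gamma> \<subseteq> I" "finite \<Gamma>" "card \<Gamma> \<le> card \<Lambda>"
  shows "N (\<lambda>x. f x - comb c \<Lambda> x) \<le> C * N (\<lambda>x. f x - comb b \<Gamma> x)"
proof -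
  have "N (\<lambda>x. f x - comb c \<Lambda> x) \<le> C * best_n_term_error M p (e ` I) (card \<Lambda>) f"
    using assms by (intro greedy) (auto simp: is_greedy_set_def)
  also have "\<dots> \<le> C * N (f - comb b \<Gamma>)"
    using assms C by (intro mult_left_mono best_n_term_error_le comb_n_term) auto
  finally show ?thesis by (simp add: fun_diff_def)
qed

text \<open>
  On the sum of both combinations, \<open>B\<close> is a greedy set, and the combination over \<open>A\<close> is a competitor
  with no more terms. The greedy remainder is the \<open>A\<close>-part, the error of the competitor the
  \<open>B\<close>-part.
\<close>

lemma comparison:
  assumes A: "A \<subseteq> I" "finite A" and B: "B \<subseteq> I" "finite B"
    and disj: "A \<inter> B = {}" and card: "card A \<le> card B"
    and ab: "\<And>i j. i \<in> A \<Longrightarrow> j \<in> B \<Longrightarrow> norm (a i) \<le> norm (b j)"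
  shows "N (comb a A) \<le> C * N (comb b B)"
proof -
  define c where "c i = (if i \<in> A then a i else if i \<in> B then b i else 0)" for i
  have c: "comb c (A \<union> B) x = comb a A x + comb b B x" for x
  proof -
    have "comb c (A \<union> B) x = comb c A x + comb c B x"
      using A B disj by (intro sum.union_disjoint) auto
    also have "comb c A x = comb a A x" by (intro sum.cong) (auto simp: c_def)
    also have "comb c B x = comb b B x" using disj by (intro sum.cong) (auto simp: c_def)
    finally show ?thesis .
  qed
  have cB: "comb c B x = comb b B x" for x
    using disj by (intro sum.cong) (auto simp: c_def)
  have "is_expansion M p I e (comb c (A \<union> B)) (\<lambda>i. if i \<in> A \<union> B then c i else 0)"
    using A B by (intro expansion_comb) auto
  moreover have "(\<lambda>i. if i \<in> A \<union> B then c i else 0) = c" by (auto simp: c_def)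
  ultimately have exp: "is_expansion M p I e (comb c (A \<union> B)) c" by simp
  have "N (\<lambda>x. comb c (A \<union> B) x - comb c B x) \<le> C * N (\<lambda>x. comb c (A \<union> B) x - comb a A x)"
    by (rule greedy_le[OF _ exp]) (use A B card ab disj in \<open>auto simp: c_def intro!: comb_X\<close>)
  then show ?thesis by (simp add: c cB)
qed

lemma coeff_bounded:
  assumes f: "f \<in> X" "is_expansion M p I e f c"
  shows "\<exists>t\<ge>0. \<forall>i. norm (c i) \<le> t"
proof -
  define r where "r n = N (\<lambda>x. f x - (\<Sum>i<n. c i * e i x))" for n
  have c0: "\<forall>i. i \<notin> I \<longrightarrow> c i = 0" and "r \<longlonglongrightarrow> 0"
    using f(2) unfolding is_expansion_def r_def by blast+
  then have "Bseq r" using convergent_imp_Bseq convergentI by blast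
  then obtain K where K: "K > 0" "\<And>n. norm (r n) \<le> K" by (auto elim: BseqE)
  \<comment> \<open>a single term is a difference of two remainders\<close>
  have "norm (c i) \<le> 2 * K / lo" for i
  proof (cases "i \<in> I")
    case True
    have X: "(\<lambda>x. f x - (\<Sum>i<n. c i * e i x)) \<in> X" for n
      using partial_sum_eq[OF c0] f by (intro X_diff) (auto intro: comb_X)
    have "(\<lambda>x. c i * e i x) = (\<lambda>x. (f x - (\<Sum>j<i. c j * e j x)) - (f x - (\<Sum>j<Suc i. c j * e j x)))"
      by (auto simp: fun_eq_iff)
    then have "N (\<lambda>x. c i * e i x) \<le> r i + r (Suc i)"
      unfolding r_def using N_triangle_diff[OF X[of i] X[of "Suc i"]] by simp
    also have "\<dots> \<le> 2 * K" using K(2)[of i] K(2)[of "Suc i"] by auto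
    finally have "norm (c i) * N (e i) \<le> 2 * K" by (simp add: N_cmult)
    moreover have "norm (c i) * lo \<le> norm (c i) * N (e i)"
      using lower[of "{i}"] True by (intro mult_left_mono) auto
    ultimately show ?thesis using lo by (simp add: field_simps)
  qed (use c0 K lo in auto)
  then show ?thesis using K(1) lo by (intro exI[of _ "2 * K / lo"]) auto
qed

text \<open>
  The argument of Konyagin and Temlyakov that greedy bases are unconditional: raise the coefficients
  on \<open>\<Lambda>\<close> to a common value \<open>t\<close> above all others. Then \<open>\<Lambda>\<close> is greedy, its remainder is that of \<open>f\<close>,
  and \<open>f\<close> itself is the error of a competitor supported on \<open>\<Lambda>\<close>.
\<close>

lemma suppression:
  assumes f: "f \<in> X" "is_expansion M p I e f c" and \<Lambda>: "\<Lambda> \<subseteq> I" "finite \<Lambda>"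
  shows "N (\<lambda>x. f x - comb c \<Lambda> x) \<le> C * N f"
proof -
  obtain t where t: "t \<ge> 0" "\<And>i. norm (c i) \<le> t" using coeff_bounded[OF f] by auto
  define b where "b i = of_real t - c i" for i
  define d where "d i = c i + (if i \<in> \<Lambda> then b i else 0)" for i
  let ?g = "\<lambda>x. f x + comb b \<Lambda> x"
  have d: "comb d \<Lambda> x = comb c \<Lambda> x + comb b \<Lambda> x" for x
    by (auto simp: d_def distrib_right sum.distrib intro!: sum.cong)
  have "N (\<lambda>x. ?g x - comb d \<Lambda> x) \<le> C * N (\<lambda>x. ?g x - comb b \<Lambda> x)"
  proof (rule greedy_le)
    show "is_expansion M p I e ?g d"
      unfolding d_def using f \<Lambda> by (rule expansion_add_comb)
    show "norm (d j) \<le> norm (d i)" if "i \<in> \<Lambda>" "j \<in> I - \<Lambda>" for i j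
      using that t by (auto simp: d_def b_def)
  qed (use f \<Lambda> in \<open>auto intro: X_add comb_X\<close>)
  then show ?thesis by (simp add: d)
qed

lemma projection_bound:
  assumes f: "f \<in> X" "is_expansion M p I e f c" and \<Lambda>: "\<Lambda> \<subseteq> I" "finite \<Lambda>"
  shows "N (comb c \<Lambda>) \<le> (1 + C) * N f"
proof -
  have "N (\<lambda>x. f x - (f x - comb c \<Lambda> x)) \<le> N f + N (\<lambda>x. f x - comb c \<Lambda> x)"
    using f \<Lambda> by (intro N_triangle_diff X_diff comb_X)
  also have "\<dots> \<le> N f + C * N f" using suppression[OF f \<Lambda>] by simp
  finally show ?thesis by (simp add: algebra_simps)
qed

lemma coefficient_le:
  assumes f: "f \<in> X" "is_expansion M p I e f c" and "i \<in> I"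
  shows "norm (c i) \<le> (1 + C) / lo * N f"
proof -
  have "norm (c i) * lo \<le> norm (c i) * N (e i)"
    using lower[of "{i}"] assms by (intro mult_left_mono) auto
  also have "\<dots> \<le> (1 + C) * N f"
    using projection_bound[OF f, of "{i}"] assms by (simp add: N_cmult)
  finally show ?thesis using lo by (simp add: field_simps)
qed

text \<open>
  A \<open>k\<close>-term approximant leaves at least \<open>k\<close> of the \<open>2k\<close> large coefficients unchanged. The remaining
  \<open>k\<close> indices of \<open>U\<close> serve as the comparison set on which all coefficients are \<open>t\<close>, so that the
  Temlyakov lower bound for plain sums applies to coefficients of arbitrary sign or argument.
\<close>

lemma large_coefficients_le_error:
  assumes f: "f \<in> X" "is_expansion M p I e f c"
    and U: "U \<subseteq> I" "finite U" "card U = 2 * k" and t: "t \<ge> 0" "\<And>i. i \<in> U \<Longrightarrow> t \<le> norm (c i)"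
  shows "t * real k powr (1 / p) \<le> C * (1 + C) / lo * best_n_term_error M p (e ` I) k f"
proof -
  have CK: "C * (1 + C) / lo > 0" using C lo by auto
  have "t * real k powr (1 / p) / (C * (1 + C) / lo) \<le> best_n_term_error M p (e ` I) k f"
  proof (rule le_best_n_term_error)
    fix g assume "g \<in> n_term (e ` I) k"
    then obtain b \<Gamma> where \<Gamma>: "\<Gamma> \<subseteq> I" "finite \<Gamma>" "card \<Gamma> \<le> k" and g: "g = comb b \<Gamma>"
      by (rule n_term_comb)
    have "k \<le> card (U - \<Gamma>)"
      using U \<Gamma> diff_card_le_card_Diff[of \<Gamma> U] by auto
    then obtain B where B: "B \<subseteq> U - \<Gamma>" "card B = k" "finite B"
      using obtain_subset_with_card_n by metis
    define A where "A = U - B"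
    have "B \<subseteq> U" using B by auto
    then have A: "A \<subseteq> I" "finite A" "card A = k" "A \<inter> B = {}"
      using B U by (auto simp: A_def card_Diff_subset)
    have B_I: "B \<subseteq> I" "\<And>i. i \<in> B \<Longrightarrow> t \<le> norm (c i)" using B U t by auto
    have "f - g = (\<lambda>x. f x + comb (\<lambda>i. - b i) \<Gamma> x)"
      by (auto simp: g fun_eq_iff sum_negf)
    then have "is_expansion M p I e (f - g) (\<lambda>i. c i + (if i \<in> \<Gamma> then - b i else 0))"
      using expansion_add_comb[OF f \<Gamma>(1,2), of "\<lambda>i. - b i"] by simp
    moreover have "f - g \<in> X"
      using fun_space.subspace_diff[OF X_subspace f(1) comb_X[OF \<Gamma>(1,2)]] by (simp add: g)
    ultimately have fg: "f - g \<in> X"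
      "is_expansion M p I e (f - g) (\<lambda>i. c i + (if i \<in> \<Gamma> then - b i else 0))" by auto
    have "comb (\<lambda>i. c i + (if i \<in> \<Gamma> then - b i else 0)) B = comb c B"
      using B by (auto simp: fun_eq_iff intro!: sum.cong)
    then have proj: "N (comb c B) \<le> (1 + C) * N (f - g)"
      using projection_bound[OF fg B_I(1) B(3)] by simp
    have "t * (lo * real k powr (1/p)) \<le> t * N (\<lambda>x. \<Sum>i\<in>A. e i x)"
      using lower[of A] A t by (intro mult_left_mono) auto
    also have "\<dots> = N (comb (\<lambda>_. of_real t) A)" using t by (simp add: N_comb_const)
    also have "\<dots> \<le> C * N (comb c B)"
      using A B B_I t by (intro comparison) auto
    also have "\<dots> \<le> C * ((1 + C) * N (f - g))" using proj C by (intro mult_left_mono) auto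
    finally have "t * real k powr (1/p) \<le> C * (1 + C) / lo * N (f - g)"
      using lo by (simp add: field_simps)
    then show "t * real k powr (1 / p) / (C * (1 + C) / lo) \<le> N (f - g)"
      using CK by (subst pos_divide_le_eq) (simp_all add: mult.commute)
  qed
  then show ?thesis using CK by (subst (asm) pos_divide_le_eq) (simp_all add: mult.commute)
qed

end

context greedy_Lp_basis
begin

lemma comb_Un:
  assumes "finite A" "finite B" "A \<inter> B = {}"
  shows "comb c (A \<union> B) = (\<lambda>x. comb c A x + comb c B x)"
  using assms by (simp add: sum.union_disjoint)

lemma N_comb_Un:
  assumes "A \<subseteq> I" "finite A" "B \<subseteq> I" "finite B" "A \<inter> B = {}"
  shows "N (comb c (A \<union> B)) \<le> N (comb c A) + N (comb c B)"
  using assms N_triangle[OF comb_X comb_X, of A B c c] by (simp add: comb_Un)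

text \<open>
  The two halves of \<open>\<Lambda>\<close> are compared with each other, so the argument also works for a finite basis,
  where no further indices need exist. For an odd number of indices one term \<open>i\<close> is left over; it is
  bounded directly.
\<close>

lemma bounded_coefficients_upper:
  assumes \<Lambda>: "\<Lambda> \<subseteq> I" "finite \<Lambda>" and t: "t \<ge> 0" "\<And>i. i \<in> \<Lambda> \<Longrightarrow> norm (c i) \<le> t"
  shows "N (comb c \<Lambda>) \<le> (2 * C + 1) * hi * t * real (card \<Lambda>) powr (1 / p)"
proof (cases "\<Lambda> = {}")
  case True
  then show ?thesis by (simp add: Lp_norm_zero)
next
  case False
  define s where "s = hi * t * real (card \<Lambda>) powr (1 / p)"
  \<comment> \<open>\<open>comparison\<close> against the constant coefficients \<open>t\<close> on a disjoint part of \<open>\<Lambda>\<close>\<close>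
  have half: "N (comb c A) \<le> C * s"
    if "A \<subseteq> \<Lambda>" "B \<subseteq> \<Lambda>" "A \<inter> B = {}" "card A \<le> card B" for A B
  proof -
    have fin: "A \<subseteq> I" "finite A" "B \<subseteq> I" "finite B"
      using that \<Lambda> by (auto intro: finite_subset)
    have "N (comb c A) \<le> C * N (comb (\<lambda>_. of_real t) B)"
      using that t fin by (intro comparison) auto
    also have "\<dots> \<le> C * (t * (hi * real (card B) powr (1 / p)))"
      using upper[of B] fin t C by (simp add: N_comb_const mult_left_mono)
    also have "\<dots> \<le> C * s"
    proof -
      have "real (card B) powr (1 / p) \<le> real (card \<Lambda>) powr (1 / p)"
        using p card_mono[OF \<Lambda>(2) that(2)] by (intro powr_mono2) auto
      then have "t * hi * real (card B) powr (1 / p) \<le> t * hi * real (card \<Lambda>) powr (1 / p)"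
        using t hi by (intro mult_left_mono) auto
      then show ?thesis using C by (simp add: s_def mult_ac)
    qed
    finally show ?thesis .
  qed
  obtain A where A: "A \<subseteq> \<Lambda>" "card A = card \<Lambda> div 2"
    using obtain_subset_with_card_n[of "card \<Lambda> div 2" \<Lambda>] by auto
  have finA: "finite A" using A \<Lambda> by (auto intro: finite_subset)
  have cardB: "card (\<Lambda> - A) = card \<Lambda> - card \<Lambda> div 2"
    using A finA by (simp add: card_Diff_subset)
  moreover have "card \<Lambda> > 0" using False \<Lambda> by (simp add: card_gt_0_iff)
  ultimately have "\<Lambda> - A \<noteq> {}" by (intro notI) simp
  then obtain i where i: "i \<in> \<Lambda> - A" by blast
  define B where "B = \<Lambda> - A - {i}"
  have B: "card B = card \<Lambda> - card \<Lambda> div 2 - 1" "finite B"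
    using i cardB \<Lambda> by (auto simp: B_def)
  have \<Lambda>_eq: "\<Lambda> = (A \<union> B) \<union> {i}" using A i by (auto simp: B_def)
  have "N (comb c {i}) = norm (c i) * N (e i)" by (simp add: N_cmult)
  also have "\<dots> \<le> t * (hi * 1)"
    using upper[of "{i}"] i t \<Lambda> by (intro mult_mono) (auto simp: Lp_norm_nonneg)
  also have "\<dots> \<le> s"
  proof -
    have "1 \<le> real (card \<Lambda>) powr (1 / p)"
      using \<open>card \<Lambda> > 0\<close> p by (intro ge_one_powr_ge_zero) auto
    then have "hi * t * 1 \<le> s" unfolding s_def using hi t by (intro mult_left_mono) auto
    then show ?thesis by (simp add: mult.commute)
  qed
  finally have Ni: "N (comb c {i}) \<le> s" .
  have "N (comb c ((A \<union> B) \<union> {i})) \<le> N (comb c (A \<union> B)) + N (comb c {i})"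
    using A i \<Lambda> finA B by (intro N_comb_Un) (auto simp: B_def)
  also have "N (comb c (A \<union> B)) \<le> N (comb c A) + N (comb c B)"
    using A i \<Lambda> finA B by (intro N_comb_Un) (auto simp: B_def)
  also have "N (comb c A) \<le> C * s"
    using A cardB by (intro half[of A "\<Lambda> - A"]) auto
  also have "N (comb c B) \<le> C * s"
    using A B by (intro half[of B A]) (auto simp: B_def)
  also note Ni
  finally show ?thesis using \<Lambda>_eq by (simp add: s_def algebra_simps)
qed

text \<open>
  Chebyshev's inequality for the counting measure on \<open>\<Lambda>\<close>.
\<close>

lemma card_large_le:
  fixes c :: "nat \<Rightarrow> 'k"
  assumes "finite \<Lambda>" "(\<Sum>i\<in>\<Lambda>. norm (c i) powr \<sigma>) = s powr \<sigma>" "s > 0" "\<sigma> > 0" "t > 0"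
  shows "real (card {i\<in>\<Lambda>. s * t < norm (c i)}) \<le> t powr (- \<sigma>)"
proof -
  let ?A = "{i\<in>\<Lambda>. s * t < norm (c i)}"
  have "real (card ?A) * (s * t) powr \<sigma> = (\<Sum>i\<in>?A. (s * t) powr \<sigma>)" by simp
  also have "\<dots> \<le> (\<Sum>i\<in>?A. norm (c i) powr \<sigma>)"
    using assms by (intro sum_mono powr_mono2) auto
  also have "\<dots> \<le> s powr \<sigma>"
    using assms by (subst assms(2)[symmetric], intro sum_mono2) auto
  finally have "real (card ?A) * t powr \<sigma> * s powr \<sigma> \<le> 1 * s powr \<sigma>"
    using assms by (simp add: powr_mult mult_ac)
  then have "real (card ?A) * t powr \<sigma> \<le> 1"
    using assms by (subst (asm) mult_le_cancel_right) auto
  then show ?thesis using assms by (simp add: powr_minus field_simps)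
qed

text \<open>
  At level \<open>J\<close> there are at most \<open>2 powr ((J + 1) * \<sigma>)\<close> coefficients larger than \<open>s * 2 powr - (J + 1)\<close>,
  where \<open>s\<close> is the \<open>\<ell>\<^sup>\<sigma>\<close>-norm. The level thus contributes at most a multiple of
  \<open>s * 2 powr (J * (\<sigma> / p - 1))\<close>, a geometric series as \<open>\<sigma> < p\<close>.
\<close>

lemma ell_sigma_upper:
  assumes \<sigma>: "0 < \<sigma>" "\<sigma> < p"
  obtains K where "K \<ge> 0" "\<And>c \<Lambda>. \<Lambda> \<subseteq> I \<Longrightarrow> finite \<Lambda> \<Longrightarrow>
    N (comb c \<Lambda>) \<le> K * (\<Sum>i\<in>\<Lambda>. norm (c i) powr \<sigma>) powr (1 / \<sigma>)"
proof -
  define \<rho> where "\<rho> = 2 powr (\<sigma> / p - 1)"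
  define D where "D = (2 * C + 1) * hi * 2 powr (\<sigma> / p)"
  have \<rho>: "0 < \<rho>" "\<rho> < 1"
    using \<sigma> by (auto simp: \<rho>_def intro!: powr_less_one)
  have D: "D \<ge> 0" using C hi by (simp add: D_def)
  have main: "N (comb c \<Lambda>) \<le> D / (1 - \<rho>) * (\<Sum>i\<in>\<Lambda>. norm (c i) powr \<sigma>) powr (1 / \<sigma>)"
    if \<Lambda>: "\<Lambda> \<subseteq> I" "finite \<Lambda>" for c \<Lambda>
  proof -
    define s where "s = (\<Sum>i\<in>\<Lambda>. norm (c i) powr \<sigma>) powr (1 / \<sigma>)"
    have s_powr: "(\<Sum>i\<in>\<Lambda>. norm (c i) powr \<sigma>) = s powr \<sigma>"
      using \<sigma> by (simp add: s_def powr_powr sum_nonneg)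
    have c_le: "norm (c i) \<le> s" if "i \<in> \<Lambda>" for i
    proof -
      have "norm (c i) powr \<sigma> \<le> (\<Sum>i\<in>\<Lambda>. norm (c i) powr \<sigma>)"
        using that \<Lambda> by (intro member_le_sum) auto
      then have "(norm (c i) powr \<sigma>) powr (1 / \<sigma>) \<le> s"
        unfolding s_def using \<sigma> by (intro powr_mono2) auto
      then show ?thesis using \<sigma> by (simp add: powr_powr)
    qed
    show ?thesis
    proof (cases "s = 0")
      case True
      then have "comb c \<Lambda> = (\<lambda>x. 0)" using c_le by (auto simp: fun_eq_iff intro!: sum.neutral)
      then show ?thesis using D \<rho> by (simp add: Lp_norm_zero)
    next
      case False
      then have s: "s > 0" by (simp add: s_def)
      define \<Lambda>' where "\<Lambda>' J = {i\<in>\<Lambda>. s * 2 powr - real J < norm (c i)}" for J :: nat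
      have \<Lambda>': "\<Lambda>' J \<subseteq> I" "finite (\<Lambda>' J)" for J using \<Lambda> by (auto simp: \<Lambda>'_def)
      \<comment> \<open>passing from \<open>J\<close> to \<open>Suc J\<close> adds the level of coefficients between \<open>s * 2 powr - Suc J\<close> and \<open>s * 2 powr - J\<close>\<close>
      have step: "N (comb c (\<Lambda>' J)) \<le> D * s * (\<Sum>j<J. \<rho> ^ j)" for J
      proof (induction J)
        case 0
        have "\<Lambda>' 0 = {}" using c_le by (force simp: \<Lambda>'_def)
        then show ?case by (simp add: Lp_norm_zero)
      next
        case (Suc J)
        define B where "B = \<Lambda>' (Suc J) - \<Lambda>' J"
        have B: "B \<subseteq> I" "finite B" using \<Lambda>' by (auto simp: B_def)
        have "\<Lambda>' J \<subseteq> \<Lambda>' (Suc J)"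
        proof -
          have "s * 2 powr - real (Suc J) \<le> s * 2 powr - real J"
            using s by (intro mult_left_mono) auto
          then show ?thesis by (force simp: \<Lambda>'_def)
        qed
        then have \<Lambda>_eq: "\<Lambda>' (Suc J) = \<Lambda>' J \<union> B" by (auto simp: B_def)
        have "real (card B) \<le> real (card (\<Lambda>' (Suc J)))"
          using \<Lambda>' by (auto simp: B_def intro!: card_mono)
        also have "\<dots> \<le> (2 powr - real (Suc J)) powr - \<sigma>"
          unfolding \<Lambda>'_def using \<Lambda> s_powr s \<sigma> by (intro card_large_le) auto
        finally have "real (card B) powr (1 / p) \<le> ((2 powr - real (Suc J)) powr - \<sigma>) powr (1 / p)"
          using p by (intro powr_mono2) auto
        also have "\<dots> = 2 powr (\<sigma> / p) * 2 powr (\<sigma> / p * real J)"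
          by (simp add: powr_powr powr_add[symmetric] field_simps)
        finally have card_B: "real (card B) powr (1 / p) \<le> 2 powr (\<sigma> / p) * 2 powr (\<sigma> / p * real J)" .
        have "N (comb c B) \<le> (2 * C + 1) * hi * (s * 2 powr - real J) * real (card B) powr (1 / p)"
          using B s by (intro bounded_coefficients_upper) (auto simp: B_def \<Lambda>'_def)
        also have "\<dots> \<le> (2 * C + 1) * hi * (s * 2 powr - real J) *
            (2 powr (\<sigma> / p) * 2 powr (\<sigma> / p * real J))"
          using card_B C hi s by (intro mult_left_mono) auto
        also have "\<dots> = D * s * (2 powr - real J * 2 powr (\<sigma> / p * real J))"
          by (simp add: D_def mult_ac)
        also have "2 powr - real J * 2 powr (\<sigma> / p * real J) = \<rho> ^ J"
          by (simp add: \<rho>_def powr_add[symmetric] powr_realpow[symmetric] powr_powr algebra_simps)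
        finally have "N (comb c B) \<le> D * s * \<rho> ^ J" .
        moreover have "N (comb c (\<Lambda>' J \<union> B)) \<le> N (comb c (\<Lambda>' J)) + N (comb c B)"
          using \<Lambda>' B by (intro N_comb_Un) (auto simp: B_def)
        ultimately show ?case using Suc by (simp add: \<Lambda>_eq distrib_left)
      qed
      \<comment> \<open>as \<open>\<Lambda>\<close> is finite, finitely many levels exhaust the nonzero coefficients\<close>
      have "\<exists>J. \<forall>i\<in>\<Lambda>. c i \<noteq> 0 \<longrightarrow> i \<in> \<Lambda>' J"
      proof -
        have "(\<lambda>J. s * 2 powr - real J) \<longlonglongrightarrow> s * 0"
        proof (intro tendsto_mult tendsto_const)
          have "2 powr - real J = (1/2) ^ J" for J
            by (simp add: powr_minus powr_realpow power_divide inverse_eq_divide)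
          moreover have "(\<lambda>J. (1/2::real) ^ J) \<longlonglongrightarrow> 0" by (intro LIMSEQ_realpow_zero) auto
          ultimately show "(\<lambda>J. 2 powr - real J) \<longlonglongrightarrow> 0" by (simp only:)
        qed
        then have "eventually (\<lambda>J. s * 2 powr - real J < norm (c i)) sequentially"
          if "c i \<noteq> 0" for i using that by (intro order_tendstoD(2)) auto
        then have "eventually (\<lambda>J. \<forall>i\<in>\<Lambda>. c i \<noteq> 0 \<longrightarrow> s * 2 powr - real J < norm (c i)) sequentially"
          using \<Lambda>(2) by (intro eventually_ball_finite) (auto intro: eventually_mono)
        then show ?thesis by (auto simp: \<Lambda>'_def eventually_sequentially)
      qed
      then obtain J where J: "\<forall>i\<in>\<Lambda>. c i \<noteq> 0 \<longrightarrow> i \<in> \<Lambda>' J" by blast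
      have "comb c \<Lambda> = comb c (\<Lambda>' J)"
        using \<Lambda> J by (auto simp: fun_eq_iff \<Lambda>'_def intro!: sum.mono_neutral_right)
      then have "N (comb c \<Lambda>) \<le> D * s * (\<Sum>j<J. \<rho> ^ j)" using step by simp
      also have "(\<Sum>j<J. \<rho> ^ j) = (1 - \<rho> ^ J) / (1 - \<rho>)"
        using \<rho> by (simp add: sum_gp_strict)
      also have "D * s * \<dots> \<le> D * s * (1 / (1 - \<rho>))"
        using D s \<rho> by (intro mult_left_mono divide_right_mono) auto
      finally show ?thesis by (simp add: s_def)
    qed
  qed
  show thesis
    by (rule that[of "D / (1 - \<rho>)"]) (use main D \<rho> in auto)
qed

text \<open>
  \<open>B n\<close> plays the role of a bound for the decreasing rearrangement at position \<open>2 ^ Suc n\<close>; stating it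
  through sets on which all entries are large avoids sorting. In the inductive step the entries above
  \<open>B n\<close> number at most \<open>2 ^ Suc n\<close>, and at most \<open>2 ^ (n + 2)\<close> others remain.
\<close>

lemma sum_by_levels:
  fixes c :: "nat \<Rightarrow> 'k" and B :: "nat \<Rightarrow> real"
  assumes "finite T" "\<sigma> > 0" "card T \<le> 2 ^ Suc n"
    and "\<And>i. i \<in> T \<Longrightarrow> norm (c i) \<le> b" and "\<And>n. B n \<ge> 0"
    and "\<And>n U t. U \<subseteq> T \<Longrightarrow> card U = 2 ^ Suc n \<Longrightarrow> t \<ge> 0 \<Longrightarrow> (\<And>i. i \<in> U \<Longrightarrow> t \<le> norm (c i)) \<Longrightarrow> t \<le> B n"
  shows "(\<Sum>i\<in>T. norm (c i) powr \<sigma>) \<le> 2 * b powr \<sigma> + (\<Sum>m<n. 2 ^ (m + 2) * B m powr \<sigma>)"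
  using assms
proof (induction n arbitrary: T)
  case 0
  have "(\<Sum>i\<in>T. norm (c i) powr \<sigma>) \<le> of_nat (card T) * b powr \<sigma>"
    using 0 by (intro sum_bounded_above powr_mono2) auto
  also have "\<dots> \<le> 2 * b powr \<sigma>" using 0 by (intro mult_right_mono) auto
  finally show ?case by simp
next
  case (Suc n)
  define L where "L = {i\<in>T. B n < norm (c i)}"
  have L: "L \<subseteq> T" "finite L" using Suc.prems by (auto simp: L_def)
  have "card L \<le> 2 ^ Suc n"
  proof (rule ccontr)
    assume "\<not> ?thesis"
    then obtain U where U: "U \<subseteq> L" "card U = 2 ^ Suc n" "finite U"
      using obtain_subset_with_card_n[of "2 ^ Suc n" L] by auto
    then have ne: "U \<noteq> {}" by auto
    have "Min ((\<lambda>i. norm (c i)) ` U) \<le> B n"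
      using U L ne by (intro Suc.prems(6)[of U]) auto
    moreover have "B n < Min ((\<lambda>i. norm (c i)) ` U)"
      using U ne by (subst Min_gr_iff) (auto simp: L_def)
    ultimately show False by simp
  qed
  moreover have "t \<le> B m"
    if "U \<subseteq> L" "card U = 2 ^ Suc m" "t \<ge> 0" "\<And>i. i \<in> U \<Longrightarrow> t \<le> norm (c i)" for m U t
    using Suc.prems(6)[OF _ that(2-4)] that(1) L(1) by auto
  ultimately have "(\<Sum>i\<in>L. norm (c i) powr \<sigma>)
      \<le> 2 * b powr \<sigma> + (\<Sum>m<n. 2 ^ (m + 2) * B m powr \<sigma>)"
    by (intro Suc.IH[OF L(2) Suc.prems(2)]) (use L Suc.prems(4,5) in auto)
  moreover have "(\<Sum>i\<in>T - L. norm (c i) powr \<sigma>) \<le> 2 ^ (n + 2) * B n powr \<sigma>"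
  proof -
    have "(\<Sum>i\<in>T - L. norm (c i) powr \<sigma>) \<le> of_nat (card (T - L)) * B n powr \<sigma>"
      using Suc.prems by (intro sum_bounded_above powr_mono2) (auto simp: L_def)
    also have "\<dots> \<le> 2 ^ (n + 2) * B n powr \<sigma>"
    proof (intro mult_right_mono)
      have "card (T - L) \<le> 2 ^ (n + 2)"
        using card_mono[of T "T - L"] Suc.prems by auto
      then show "real (card (T - L)) \<le> 2 ^ (n + 2)"
        by (metis of_nat_le_iff of_nat_numeral of_nat_power)
    qed auto
    finally show ?thesis .
  qed
  moreover have "(\<Sum>i\<in>T. norm (c i) powr \<sigma>) =
      (\<Sum>i\<in>L. norm (c i) powr \<sigma>) + (\<Sum>i\<in>T - L. norm (c i) powr \<sigma>)"
    using L Suc.prems by (subst sum.subset_diff[of L T]) auto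
  ultimately show ?case by simp
qed

text \<open>
  A set of \<open>2 ^ Suc m\<close> coefficients of size at least \<open>t\<close> forces \<open>t\<close> to be at most a multiple of the
  \<open>2 ^ m\<close>-term error times \<open>2 powr (- m / p)\<close>. The weight \<open>2 ^ m\<close> of the level turns the \<open>\<sigma>\<close>-th power of
  this bound into the \<open>m\<close>-th term of the approximation norm, because \<open>\<alpha> * \<sigma> = 1 - \<sigma> / p\<close>.
\<close>

lemma coefficients_ell_sigma:
  assumes \<sigma>: "0 < \<sigma>" "\<alpha> = 1 / \<sigma> - 1 / p"
  obtains K where "K \<ge> 0" "\<And>f c T A. f \<in> X \<Longrightarrow> is_expansion M p I e f c \<Longrightarrow> T \<subseteq> I \<Longrightarrow> finite T \<Longrightarrow>
    (\<And>n. (\<Sum>m<n. (2 powr (real m * \<alpha>) * best_n_term_error M p (e ` I) (2 ^ m) f) powr \<sigma>) \<le> A) \<Longrightarrow>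
    (\<Sum>i\<in>T. norm (c i) powr \<sigma>) \<le> K * (N f powr \<sigma> + A)"
proof -
  define b where "b = (1 + C) / lo"
  define G where "G = C * (1 + C) / lo"
  have b: "b \<ge> 0" and G: "G \<ge> 0" using C lo by (auto simp: b_def G_def)
  have main: "(\<Sum>i\<in>T. norm (c i) powr \<sigma>) \<le> (2 * b powr \<sigma> + 4 * G powr \<sigma>) * (N f powr \<sigma> + A)"
    if f: "f \<in> X" "is_expansion M p I e f c" and T: "T \<subseteq> I" "finite T"
      and A: "\<And>n. (\<Sum>m<n. (2 powr (real m * \<alpha>) * best_n_term_error M p (e ` I) (2 ^ m) f) powr \<sigma>) \<le> A"
    for f c T A
  proof -
    define E where "E m = best_n_term_error M p (e ` I) (2 ^ m) f" for m
    have E: "E m \<ge> 0" for m by (simp add: E_def best_n_term_error_nonneg)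
    define B where "B m = G * E m / (2 ^ m) powr (1 / p)" for m :: nat
    have card_T: "card T \<le> 2 ^ Suc (card T)"
      using less_exp[of "Suc (card T)"] by simp
    have "(\<Sum>i\<in>T. norm (c i) powr \<sigma>) \<le> 2 * (b * N f) powr \<sigma> + (\<Sum>m<card T. 2 ^ (m + 2) * B m powr \<sigma>)"
    proof (rule sum_by_levels[OF T(2) \<sigma>(1) card_T])
      show "norm (c i) \<le> b * N f" if "i \<in> T" for i
        using coefficient_le[OF f, of i] that T by (auto simp: b_def)
      show "B m \<ge> 0" for m using G E by (simp add: B_def)
      fix m U t assume U: "U \<subseteq> T" "card U = 2 ^ Suc m" "t \<ge> 0" "\<And>i. i \<in> U \<Longrightarrow> t \<le> norm (c i)"
      have "t * real (2 ^ m) powr (1 / p) \<le> G * E m"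
        unfolding G_def E_def using U T
        by (intro large_coefficients_le_error[OF f, of U]) (auto intro: finite_subset)
      then show "t \<le> B m" by (simp add: B_def field_simps)
    qed
    also have "2 * (b * N f) powr \<sigma> = 2 * b powr \<sigma> * N f powr \<sigma>"
      using b by (simp add: powr_mult)
    also have "(\<Sum>m<card T. 2 ^ (m + 2) * B m powr \<sigma>) =
        4 * G powr \<sigma> * (\<Sum>m<card T. (2 powr (real m * \<alpha>) * E m) powr \<sigma>)"
    proof -
      have "2 ^ (m + 2) * B m powr \<sigma> = 4 * G powr \<sigma> * (2 powr (real m * \<alpha>) * E m) powr \<sigma>" for m :: nat
      proof -
        have "2 ^ m / (2 powr (real m * (1 / p))) powr \<sigma> = (2 powr (real m * \<alpha>)) powr \<sigma>"
        proof -
          have "real m * \<alpha> * \<sigma> = real m - real m * (1 / p) * \<sigma>"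
            using \<sigma>(1) by (simp add: \<sigma>(2) algebra_simps)
          then have "(2 powr (real m * \<alpha>)) powr \<sigma> = 2 powr (real m - real m * (1 / p) * \<sigma>)"
            by (simp only: powr_powr)
          then show ?thesis by (simp add: powr_powr powr_realpow powr_diff)
        qed
        moreover have "(2 ^ m) powr (1 / p) = (2::real) powr (real m * (1 / p))"
          by (simp add: powr_powr powr_realpow[symmetric])
        ultimately show ?thesis
          using G E[of m] by (simp add: B_def powr_mult powr_divide power_add field_simps)
      qed
      then show ?thesis unfolding sum_distrib_left by (intro sum.cong refl)
    qed
    also have "2 * b powr \<sigma> * N f powr \<sigma> + 4 * G powr \<sigma> * (\<Sum>m<card T. (2 powr (real m * \<alpha>) * E m) powr \<sigma>)
        \<le> 2 * b powr \<sigma> * N f powr \<sigma> + 4 * G powr \<sigma> * A"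
      using A[of "card T"] by (auto simp: E_def intro!: mult_left_mono)
    also have "\<dots> \<le> (2 * b powr \<sigma> + 4 * G powr \<sigma>) * (N f powr \<sigma> + A)"
      using A[of 0] by (simp add: algebra_simps)
    finally show ?thesis .
  qed
  show thesis
    by (rule that[of "2 * b powr \<sigma> + 4 * G powr \<sigma>"]) (use main in auto)
qed

end

section \<open>Atoms, rings and local functions\<close>

text \<open>
  The position of an atom or ring \<open>R\<close> relative to an atom \<open>C\<close> in which a function living on \<open>C\<close> need
  not be in \<open>S\<close> on \<open>R\<close>: up to a properly smaller atom, \<open>R\<close> contains \<open>C\<close>.
\<close>

definition crosses :: "(nat \<Rightarrow> 'a measure) \<Rightarrow> 'a set \<Rightarrow> 'a set \<Rightarrow> bool" where
  "crosses F R C \<longleftrightarrow> (\<exists>D. R \<inter> C = C - D \<and> (D = {} \<or> D \<in> filt_atoms F \<and> D \<subset> C))"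

context nary_filtration
begin

lemma atom_sets: "A \<in> sigma_atoms (F n) \<Longrightarrow> A \<in> sets M"
  using subalg[of n] by (auto simp: sigma_atoms_def subalgebra_def)

lemma filt_atom_sets: "A \<in> filt_atoms F \<Longrightarrow> A \<in> sets M"
  using atom_sets by (auto simp: filt_atoms_def)

lemma filt_ring_sets: "R \<in> filt_rings F \<Longrightarrow> R \<in> sets M"
  using filt_atom_sets by (auto simp: filt_rings_def)

lemma filt_atom_nonempty: "A \<in> filt_atoms F \<Longrightarrow> A \<noteq> {}"
  by (auto simp: filt_atoms_def sigma_atoms_def)

lemma finer_atom_subset_or_disjoint:
  assumes "A \<in> sigma_atoms (F m)" "C \<in> sigma_atoms (F n)" "m \<le> n"
  shows "C \<subseteq> A \<or> A \<inter> C = {}"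
proof -
  have "A \<in> sets (F n)" "C \<in> sets (F n)"
    using assms sets_F_mono[OF assms(3)] by (auto simp: sigma_atoms_def)
  then have "A \<inter> C \<in> sets (F n)" by blast
  then have "A \<inter> C = {} \<or> A \<inter> C = C" using assms(2) by (auto simp: sigma_atoms_def)
  then show ?thesis by blast
qed

lemma filt_atoms_laminar:
  assumes "A \<in> filt_atoms F" "C \<in> filt_atoms F"
  shows "A \<subseteq> C \<or> C \<subseteq> A \<or> A \<inter> C = {}"
proof -
  obtain m n where mn: "A \<in> sigma_atoms (F m)" "C \<in> sigma_atoms (F n)"
    using assms by (auto simp: filt_atoms_def)
  show ?thesis
    using finer_atom_subset_or_disjoint[OF mn] finer_atom_subset_or_disjoint[OF mn(2,1)]
    by (metis Int_commute linear)
qed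

lemma space_atom: "space M \<in> sigma_atoms (F 0)"
  using sets_F_0 not_empty by (auto simp: sigma_atoms_def)

lemma atoms_cover:
  assumes "x \<in> space M"
  shows "\<exists>A\<in>sigma_atoms (F n). x \<in> A"
proof (induction n)
  case 0
  show ?case using space_atom assms by blast
next
  case (Suc n)
  then obtain A where A: "A \<in> sigma_atoms (F n)" "x \<in> A" by blast
  obtain \<B> where "\<B> \<subseteq> sigma_atoms (F (Suc n))" "A = \<Union>\<B>"
    using nary[OF A(1)] by blast
  then show ?case using A(2) by blast
qed

lemma atom_subset_coarser_atom:
  assumes A: "A \<in> sigma_atoms (F m)" and "n \<le> m"
  obtains B where "B \<in> sigma_atoms (F n)" "A \<subseteq> B"
proof -
  obtain x where x: "x \<in> A" using A by (auto simp: sigma_atoms_def)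
  then have "x \<in> space M" using sets.sets_into_space[OF atom_sets[OF A]] by blast
  then obtain B where B: "B \<in> sigma_atoms (F n)" "x \<in> B" using atoms_cover by blast
  then show thesis using finer_atom_subset_or_disjoint[OF B(1) A assms(2)] x that by blast
qed

text \<open>
  If two crossing sets are disjoint, the parts \<open>D\<close>, \<open>D'\<close> of \<open>C\<close> that they miss cover \<open>C\<close>. Both are
  therefore nonempty, so they are proper subatoms, and by laminarity they are disjoint. Three such
  sets would be pairwise complementary in \<open>C\<close>, which is impossible.
\<close>

lemma card_crossing_le_2:
  assumes C: "C \<in> filt_atoms F" and \<P>: "disjoint \<P>"
  shows "card {R\<in>\<P>. crosses F R C} \<le> 2"
proof (rule ccontr)
  assume "\<not> ?thesis"
  then have "3 \<le> card {R\<in>\<P>. crosses F R C}" by simp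
  then obtain T where T: "T \<subseteq> {R\<in>\<P>. crosses F R C}" "card T = 3"
    using obtain_subset_with_card_n by metis
  then obtain R1 R2 R3 where R: "R1 \<noteq> R2" "R2 \<noteq> R3" "R1 \<noteq> R3" "T = {R1, R2, R3}"
    by (auto simp: card_3_iff)
  have disj: "R1 \<inter> R2 = {}" "R2 \<inter> R3 = {}" "R1 \<inter> R3 = {}"
    using R T \<P> by (auto simp: pairwise_def disjnt_def)
  have "crosses F R1 C" "crosses F R2 C" "crosses F R3 C" using R(4) T(1) by simp_all
  then obtain D1 D2 D3 where D:
    "R1 \<inter> C = C - D1" "D1 = {} \<or> D1 \<in> filt_atoms F \<and> D1 \<subset> C"
    "R2 \<inter> C = C - D2" "D2 = {} \<or> D2 \<in> filt_atoms F \<and> D2 \<subset> C"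
    "R3 \<inter> C = C - D3" "D3 = {} \<or> D3 \<in> filt_atoms F \<and> D3 \<subset> C"
    unfolding crosses_def by metis
  have sub: "D1 \<subseteq> C" "D2 \<subseteq> C" "D3 \<subseteq> C" using D by auto
  have cover: "D \<union> D' = C" if "R \<inter> C = C - D" "R' \<inter> C = C - D'" "R \<inter> R' = {}" "D \<subseteq> C" "D' \<subseteq> C"
    for R R' D D' using that by blast
  have un: "D1 \<union> D2 = C" "D2 \<union> D3 = C" "D1 \<union> D3 = C"
    using cover[OF D(1,3) disj(1) sub(1,2)] cover[OF D(3,5) disj(2) sub(2,3)]
      cover[OF D(1,5) disj(3) sub(1,3)] by simp_all
  have "C \<noteq> {}" using C by (rule filt_atom_nonempty)
  have proper: "D1 \<noteq> C" "D2 \<noteq> C" "D3 \<noteq> C" using D \<open>C \<noteq> {}\<close> by auto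
  then have "D1 \<noteq> {}" "D2 \<noteq> {}" "D3 \<noteq> {}" using un by auto
  then have at: "D1 \<in> filt_atoms F" "D2 \<in> filt_atoms F" "D3 \<in> filt_atoms F"
    using D by auto
  have disjoint_pair: "D \<inter> D' = {}"
    if "D \<in> filt_atoms F" "D' \<in> filt_atoms F" "D \<union> D' = C" "D \<noteq> C" "D' \<noteq> C" for D D'
    using filt_atoms_laminar[OF that(1,2)] that(3-5) by (auto simp: sup.absorb1 sup.absorb2)
  have "D1 \<inter> D2 = {}" "D2 \<inter> D3 = {}" "D1 \<inter> D3 = {}"
    using disjoint_pair at un proper by simp_all
  then have "D1 = {}" using un by blast
  then show False using \<open>D1 \<noteq> {}\<close> by simp
qed

end

context local_orthonormal_system
begin

lemma S_subspace: "fun_space.subspace S"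
  using S_finite_dim by auto

lemma S_zero: "(\<lambda>x. 0) \<in> S"
  using fun_space.subspace_0[OF S_subspace] by (simp add: zero_fun_def)

lemma S_diff: "f \<in> S \<Longrightarrow> g \<in> S \<Longrightarrow> (\<lambda>x. f x - g x) \<in> S"
  using fun_space.subspace_diff[OF S_subspace] by (simp add: fun_diff_def)

lemma S_cmult: "f \<in> S \<Longrightarrow> (\<lambda>x. c * f x) \<in> S"
  using fun_space.subspace_scale[OF S_subspace] by simp

lemma Phi_in_range: "\<phi> \<in> \<Phi> n \<Longrightarrow> \<phi> \<in> proj_increment_range M F S n"
  using Phi_orthonormal_basis[of n] by (auto simp: is_orthonormal_basis_def)

text \<open>
  Atoms of level \<open>n\<close> lie in atoms of level \<open>n - 1\<close>, so both projections are given by elements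
  of \<open>S\<close> there.
\<close>

lemma Phi_piecewise:
  assumes "\<phi> \<in> \<Phi> n" "A \<in> sigma_atoms (F n)"
  shows "\<exists>h\<in>S. AE x in M. x \<in> A \<longrightarrow> \<phi> x = h x"
proof -
  obtain f u v where u: "is_orth_proj M (piecewise_S F S n) f u"
    and v: "case n of 0 \<Rightarrow> v = 0 | Suc m \<Rightarrow> is_orth_proj M (piecewise_S F S m) f v"
    and \<phi>: "AE x in M. \<phi> x = u x - v x"
    using Phi_in_range[OF assms(1)] unfolding proj_increment_range_def by auto
  obtain g where g: "g \<in> S" "\<forall>x\<in>A. u x = g x"
    using u assms(2) by (auto simp: is_orth_proj_def piecewise_S_def)
  have "\<exists>g'\<in>S. \<forall>x\<in>A. v x = g' x"
  proof (cases n)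
    case 0
    then show ?thesis using v S_zero by (auto intro!: bexI[of _ "\<lambda>x. 0"])
  next
    case (Suc m)
    obtain B where B: "B \<in> sigma_atoms (F m)" "A \<subseteq> B"
      using atom_subset_coarser_atom[OF assms(2), of m] Suc by auto
    then have "\<exists>g'\<in>S. \<forall>x\<in>B. v x = g' x"
      using v Suc by (auto simp: is_orth_proj_def piecewise_S_def)
    then show ?thesis using B by blast
  qed
  then obtain g' where "g' \<in> S" "\<forall>x\<in>A. v x = g' x" by blast
  then show ?thesis
    using g \<phi> S_diff by (intro bexI[of _ "\<lambda>x. g x - g' x"]) (auto elim!: AE_mp)
qed

text \<open>
  A function in \<open>\<Phi> (Suc m)\<close> lives on an atom \<open>C\<close> of level \<open>m\<close>. On atoms of later levels it is in \<open>S\<close>,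
  and an atom of level at most \<open>m\<close> is either disjoint from \<open>C\<close>, where the function vanishes, or
  contains \<open>C\<close>. For a ring \<open>A - B\<close> with \<open>A\<close> containing \<open>C\<close> it remains to see where \<open>B\<close> lies: if it
  contains \<open>C\<close> the function vanishes on the ring, otherwise the ring crosses \<open>C\<close>. The functions
  in \<open>\<Phi> 0\<close> are in \<open>S\<close> on the whole space, so any atom will do for them.
\<close>

lemma Phi_local_structure:
  assumes "\<phi> \<in> (\<Union>n. \<Phi> n)"
  shows "\<exists>C\<in>filt_atoms F. \<forall>R\<in>filt_atoms F \<union> filt_rings F.
    (\<exists>h\<in>S. AE x in M. x \<in> R \<longrightarrow> \<phi> x = h x) \<or> crosses F R C"
proof -
  obtain n where n: "\<phi> \<in> \<Phi> n" using assms by blast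
  have on_subset: "\<exists>h\<in>S. AE x in M. x \<in> R \<longrightarrow> \<phi> x = h x"
    if "h \<in> S" "AE x in M. x \<in> A \<longrightarrow> \<phi> x = h x" "R \<subseteq> A" for h A R
    using that by (intro bexI[of _ h]) (auto elim!: AE_mp)
  have R_sub: "R \<subseteq> space M" if "R \<in> filt_atoms F \<union> filt_rings F" for R
    using that filt_atom_sets filt_ring_sets sets.sets_into_space by blast
  show ?thesis
  proof (cases n)
    case 0
    obtain h where "h \<in> S" "AE x in M. x \<in> space M \<longrightarrow> \<phi> x = h x"
      using Phi_piecewise[OF n] space_atom 0 by blast
    then have "\<forall>R\<in>filt_atoms F \<union> filt_rings F. \<exists>h\<in>S. AE x in M. x \<in> R \<longrightarrow> \<phi> x = h x"
      using on_subset R_sub by blast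
    moreover have "space M \<in> filt_atoms F" using space_atom by (auto simp: filt_atoms_def)
    ultimately show ?thesis by blast
  next
    case (Suc m)
    obtain C where C: "C \<in> sigma_atoms (F m)" and supp: "AE x in M. x \<notin> C \<longrightarrow> \<phi> x = 0"
      using Phi_local n Suc by blast
    have C_atom: "C \<in> filt_atoms F" using C by (auto simp: filt_atoms_def)
    have off_C: "\<exists>h\<in>S. AE x in M. x \<in> R \<longrightarrow> \<phi> x = h x" if "R \<inter> C = {}" for R
      using supp that S_zero by (intro bexI[of _ "\<lambda>x. 0"]) (auto elim!: AE_mp)
    have atom: "(\<exists>h\<in>S. AE x in M. x \<in> A \<longrightarrow> \<phi> x = h x) \<or> C \<subseteq> A" if A: "A \<in> filt_atoms F" for A
    proof -
      obtain k where k: "A \<in> sigma_atoms (F k)" using A by (auto simp: filt_atoms_def)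
      show ?thesis
      proof (cases "n \<le> k")
        case True
        obtain B where "B \<in> sigma_atoms (F n)" "A \<subseteq> B"
          using atom_subset_coarser_atom[OF k True] by blast
        then show ?thesis using Phi_piecewise[OF n] on_subset by blast
      next
        case False
        then have "C \<subseteq> A \<or> A \<inter> C = {}"
          using finer_atom_subset_or_disjoint[OF k C] Suc by auto
        then show ?thesis using off_C by blast
      qed
    qed
    have "(\<exists>h\<in>S. AE x in M. x \<in> R \<longrightarrow> \<phi> x = h x) \<or> crosses F R C"
      if "R \<in> filt_atoms F \<union> filt_rings F" for R
      using that
    proof
      assume "R \<in> filt_atoms F"
      then consider "\<exists>h\<in>S. AE x in M. x \<in> R \<longrightarrow> \<phi> x = h x" | "C \<subseteq> R"
        using atom[of R] by blast
      then show ?thesis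
      proof cases
        case 2
        then have "crosses F R C" unfolding crosses_def by (intro exI[of _ "{}"]) auto
        then show ?thesis by simp
      qed simp
    next
      assume "R \<in> filt_rings F"
      then obtain A B where R: "R = A - B" and AB: "A \<in> filt_atoms F" "B \<in> filt_atoms F"
        by (auto simp: filt_rings_def)
      consider "\<exists>h\<in>S. AE x in M. x \<in> A \<longrightarrow> \<phi> x = h x" | "C \<subseteq> A" "C \<subseteq> B"
        | "C \<subseteq> A" "B \<subset> C" | "C \<subseteq> A" "B \<inter> C = {}"
        using atom[OF AB(1)] filt_atoms_laminar[OF AB(2) C_atom] by blast
      then show ?thesis
      proof cases
        case 1
        then obtain h where "h \<in> S" "AE x in M. x \<in> A \<longrightarrow> \<phi> x = h x" by blast
        then show ?thesis using on_subset[of h A R] R by blast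
      next
        case 2
        then have "R \<inter> C = {}" using R by blast
        then show ?thesis using off_C[of R] by simp
      next
        case 3
        then have "R \<inter> C = C - B" using R by blast
        then have "crosses F R C" using 3 AB(2) unfolding crosses_def by (intro exI[of _ B]) simp
        then show ?thesis by simp
      next
        case 4
        then have "R \<inter> C = C - {}" using R by blast
        then have "crosses F R C" unfolding crosses_def by (intro exI[of _ "{}"]) simp
        then show ?thesis by simp
      qed
    qed
    then show ?thesis by (intro bexI[OF _ C_atom] ballI)
  qed
qed

lemma span_cuts_Lp: "fun_space.span {cut f A | f A. f \<in> S \<and> A \<in> filt_atoms F} \<subseteq> Lp_space M p"
  if p: "1 \<le> p" for p
proof (rule fun_space.span_minimal[OF _ Lp_space_subspace[OF p]], clarify)
  fix f A assume f: "f \<in> S" and A: "A \<in> filt_atoms F"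
  have [measurable]: "f \<in> borel_measurable M" "A \<in> sets M"
    using S_measurable f filt_atom_sets A by auto
  obtain b where b: "\<And>x. x \<in> space M \<Longrightarrow> norm (f x) \<le> b"
    using S_bounded[OF f] by (auto simp: bounded_iff)
  have "cut f A = (\<lambda>x. if x \<in> A then f x else 0)" by (auto simp: cut_def fun_eq_iff indicator_def)
  then have meas: "cut f A \<in> borel_measurable M" by simp
  have "integrable M (\<lambda>x. norm (cut f A x) powr p)"
  proof (rule integrable_const_bound[where B = "b powr p"])
    show "AE x in M. norm (norm (cut f A x) powr p) \<le> b powr p"
      using b p by (intro AE_I2) (auto simp: cut_def indicator_def intro!: powr_mono2)
  qed (use meas in measurable)
  then show "cut f A \<in> Lp_space M p" using meas by (simp add: Lp_space_def)
qed

lemma LpS_subspace: "1 \<le> p \<Longrightarrow> fun_space.subspace (LpS M F S p)"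
  unfolding LpS_def by (intro Lp_closure_subspace span_cuts_Lp fun_space.subspace_span)

lemma LpS_Lp: "LpS M F S p \<subseteq> Lp_space M p"
  by (auto simp: LpS_def Lp_closure_def)

end

section \<open>From coefficients to variation\<close>

lemma local_error_nonneg:
  assumes "S \<noteq> {}"
  shows "0 \<le> local_error M S p f R"
  unfolding local_error_def using assms by (intro cINF_greatest) (auto simp: Lp_norm_nonneg)

text \<open>
  The function \<open>r\<close> need only represent the error on \<open>R\<close>, but its norm is taken over the whole space;
  global norm estimates for finite combinations thus apply to local errors.
\<close>

lemma local_error_le:
  assumes f: "f \<in> borel_measurable M" and r: "r \<in> Lp_space M p" and "h \<in> S" and "h \<in> borel_measurable M"
    and R: "R \<in> sets M" and p: "p > 0" and eq: "AE x in M. x \<in> R \<longrightarrow> f x = h x + r x"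
  shows "local_error M S p f R \<le> Lp_norm M p r"
proof -
  have [measurable]: "f \<in> borel_measurable M" "h \<in> borel_measurable M" "r \<in> borel_measurable M"
    "cut h R \<in> borel_measurable M"
    using assms by (auto simp: Lp_space_def cut_def)
  have "local_error M S p f R \<le> Lp_norm (restrict_space M R) p (f - cut h R)"
    unfolding local_error_def using assms
    by (intro cINF_lower) (auto intro!: bdd_belowI[of _ 0] simp: Lp_norm_nonneg)
  also have "\<dots> = Lp_norm (restrict_space M R) p r"
  proof (rule Lp_norm_cong_AE)
    have "AE x in M. x \<in> R \<longrightarrow> (f - cut h R) x = r x"
      using eq by (rule AE_mp) (auto simp: cut_def)
    then show "AE x in restrict_space M R. (f - cut h R) x = r x"
      using R by (subst AE_restrict_space_iff) auto
    show "f - cut h R \<in> borel_measurable (restrict_space M R)"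
      unfolding fun_diff_def by (intro measurable_restrict_space1) simp
  qed (simp add: measurable_restrict_space1)
  also have "\<dots> \<le> Lp_norm M p r" using r R p by (rule Lp_norm_restrict_le)
  finally show ?thesis .
qed

text \<open>
  Distinct elements of \<open>D\<close> may have the same normalization; the coefficients over each fibre are
  added up, which can only shorten the combination.
\<close>

lemma n_term_normalize:
  assumes "\<And>\<phi>. \<phi> \<in> D \<Longrightarrow> Lp_norm M p \<phi> \<noteq> 0"
  shows "n_term D n \<subseteq> n_term (Lp_normalize M p ` D) n"
proof
  fix g assume "g \<in> n_term D n"
  then obtain c T where g: "g = (\<lambda>x. \<Sum>\<phi>\<in>T. c \<phi> * \<phi> x)" and T: "T \<subseteq> D" "finite T" "card T \<le> n"
    by (auto simp: n_term_def)
  let ?n = "Lp_normalize M p"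
  define d where "d \<psi> = (\<Sum>\<phi>\<in>{\<phi>\<in>T. ?n \<phi> = \<psi>}. c \<phi> * of_real (Lp_norm M p \<phi>))" for \<psi>
  have "g x = (\<Sum>\<psi>\<in>?n ` T. d \<psi> * \<psi> x)" for x
  proof -
    have "\<phi> x = of_real (Lp_norm M p \<phi>) * ?n \<phi> x" if "\<phi> \<in> T" for \<phi>
      using assms[of \<phi>] that T by (auto simp: Lp_normalize_def scaleR_conv_of_real)
    then have "g x = (\<Sum>\<phi>\<in>T. c \<phi> * of_real (Lp_norm M p \<phi>) * ?n \<phi> x)"
      unfolding g by (intro sum.cong refl) (metis mult.assoc)
    also have "\<dots> = (\<Sum>\<psi>\<in>?n ` T. \<Sum>\<phi>\<in>{\<phi>\<in>T. ?n \<phi> = \<psi>}. c \<phi> * of_real (Lp_norm M p \<phi>) * ?n \<phi> x)"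
      by (rule sum.image_gen[OF T(2)])
    also have "\<dots> = (\<Sum>\<psi>\<in>?n ` T. d \<psi> * \<psi> x)"
      unfolding d_def sum_distrib_right by (intro sum.cong refl) auto
    finally show ?thesis .
  qed
  moreover have "card (?n ` T) \<le> n" using card_image_le[OF T(2), of ?n] T(3) by simp
  ultimately show "g \<in> n_term (?n ` D) n"
    using T unfolding n_term_def by (intro CollectI exI[of _ d] exI[of _ "?n ` T"]) auto
qed

lemma best_n_term_error_antimono:
  assumes "n_term D n \<subseteq> n_term D' n"
  shows "best_n_term_error M p D' n f \<le> best_n_term_error M p D n f"
  using assms by (intro le_best_n_term_error best_n_term_error_le) auto

text \<open>
  The inclusion of \<open>\<ell>\<^sup>q\<close> in \<open>\<ell>\<^sup>\<sigma>\<close>: each term is at most the \<open>\<ell>\<^sup>q\<close>-norm \<open>L\<close>, so that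
  \<open>a m powr \<sigma> \<le> a m powr q * L powr (\<sigma> - q)\<close>.
\<close>

lemma sum_powr_le_powr_sum:
  fixes a :: "nat \<Rightarrow> real"
  assumes "0 < q" "q \<le> \<sigma>" "\<And>n. a n \<ge> 0" "summable (\<lambda>n. a n powr q)"
  shows "(\<Sum>m<n. a m powr \<sigma>) \<le> ((\<Sum>n. a n powr q) powr (1 / q)) powr \<sigma>"
proof -
  define L where "L = (\<Sum>n. a n powr q) powr (1 / q)"
  have nonneg: "0 \<le> (\<Sum>n. a n powr q)" using assms by (intro suminf_nonneg) auto
  have L_powr: "L powr q = (\<Sum>n. a n powr q)" using nonneg assms by (simp add: L_def powr_powr)
  have le: "a m \<le> L" for m
  proof -
    have "a m powr q \<le> (\<Sum>n. a n powr q)"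
      using assms sum_le_suminf[of "\<lambda>n. a n powr q" "{m}"] by simp
    then have "(a m powr q) powr (1 / q) \<le> L"
      unfolding L_def using assms by (intro powr_mono2) auto
    then show ?thesis using assms by (simp add: powr_powr)
  qed
  have "(\<Sum>m<n. a m powr \<sigma>) \<le> (\<Sum>m<n. a m powr q * L powr (\<sigma> - q))"
  proof (rule sum_mono)
    fix m
    have "a m powr \<sigma> = a m powr q * a m powr (\<sigma> - q)" by (simp add: powr_add[symmetric])
    also have "\<dots> \<le> a m powr q * L powr (\<sigma> - q)"
      using le assms by (intro mult_left_mono powr_mono2) auto
    finally show "a m powr \<sigma> \<le> a m powr q * L powr (\<sigma> - q)" .
  qed
  also have "\<dots> = (\<Sum>m<n. a m powr q) * L powr (\<sigma> - q)" by (simp add: sum_distrib_right)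
  also have "\<dots> \<le> L powr q * L powr (\<sigma> - q)"
    unfolding L_powr using assms by (intro mult_right_mono sum_le_suminf) auto
  also have "\<dots> = L powr \<sigma>" by (simp add: powr_add[symmetric])
  finally show ?thesis by (simp add: L_def)
qed

context local_orthonormal_system
begin

lemma S_sum:
  assumes "\<And>i. i \<in> J \<Longrightarrow> h i \<in> S"
  shows "(\<lambda>x. \<Sum>i\<in>J. c i * h i x) \<in> S"
  using assms
proof (induction J rule: infinite_finite_induct)
  case (insert i J)
  have "(\<lambda>x. c i * h i x) + (\<lambda>x. \<Sum>i\<in>J. c i * h i x) \<in> S"
    using insert by (intro fun_space.subspace_add[OF S_subspace] S_cmult) auto
  then show ?case using insert by (simp add: plus_fun_def)
qed (simp_all add: S_zero)

lemma greedy_basis_enumeration: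
  assumes p: "1 < p"
  obtains I e C lo hi where "greedy_Lp_basis M p (LpS M F S p) I e C lo hi"
    and "e ` I = Lp_normalize M p ` (\<Union>n. \<Phi> n)"
proof -
  let ?\<Psi> = "Lp_normalize M p ` (\<Union>n. \<Phi> n)"
  obtain I e C where e: "bij_betw e I ?\<Psi>" and basis: "is_schauder_basis M p (LpS M F S p) I e"
    and greedy: "\<And>f c m \<Lambda>. f \<in> LpS M F S p \<Longrightarrow> is_expansion M p I e f c \<Longrightarrow> is_greedy_set I c m \<Lambda> \<Longrightarrow>
      Lp_norm M p (\<lambda>x. f x - (\<Sum>i\<in>\<Lambda>. c i * e i x)) \<le> C * best_n_term_error M p ?\<Psi> m f"
    using Phi_greedy[OF p] unfolding is_greedy_basis_def by blast
  obtain lo hi where lo: "lo > 0" and temlyakov: "\<And>\<Lambda>. \<Lambda> \<subseteq> ?\<Psi> \<Longrightarrow> finite \<Lambda> \<Longrightarrow>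
      lo * real (card \<Lambda>) powr (1 / p) \<le> Lp_norm M p (\<lambda>x. \<Sum>\<psi>\<in>\<Lambda>. \<psi> x) \<and>
      Lp_norm M p (\<lambda>x. \<Sum>\<psi>\<in>\<Lambda>. \<psi> x) \<le> hi * real (card \<Lambda>) powr (1 / p)"
    using Phi_temlyakov[OF p] unfolding temlyakov_property_def by blast
  have inj: "inj_on e I" and img: "e ` I = ?\<Psi>" using e by (auto simp: bij_betw_def)
  have sums: "lo * real (card \<Lambda>) powr (1 / p) \<le> Lp_norm M p (\<lambda>x. \<Sum>i\<in>\<Lambda>. e i x)"
    "Lp_norm M p (\<lambda>x. \<Sum>i\<in>\<Lambda>. e i x) \<le> hi * real (card \<Lambda>) powr (1 / p)"
    if \<Lambda>: "\<Lambda> \<subseteq> I" "finite \<Lambda>" for \<Lambda>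
  proof -
    have "inj_on e \<Lambda>" using inj \<Lambda>(1) by (rule inj_on_subset)
    moreover have "e ` \<Lambda> \<subseteq> ?\<Psi>" using \<Lambda>(1) img by blast
    ultimately show "lo * real (card \<Lambda>) powr (1 / p) \<le> Lp_norm M p (\<lambda>x. \<Sum>i\<in>\<Lambda>. e i x)"
      "Lp_norm M p (\<lambda>x. \<Sum>i\<in>\<Lambda>. e i x) \<le> hi * real (card \<Lambda>) powr (1 / p)"
      using temlyakov[of "e ` \<Lambda>"] \<Lambda>(2) by (simp_all add: sum.reindex card_image)
  qed
  have "greedy_Lp_basis M p (LpS M F S p) I e (max C 1) lo (max hi 0)"
  proof
    show "fun_space.subspace (LpS M F S p)" using p by (intro LpS_subspace) simp
    show "LpS M F S p \<subseteq> Lp_space M p" by (rule LpS_Lp)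
  next
    fix f c m \<Lambda> assume "f \<in> LpS M F S p" "is_expansion M p I e f c" "is_greedy_set I c m \<Lambda>"
    then have "Lp_norm M p (\<lambda>x. f x - (\<Sum>i\<in>\<Lambda>. c i * e i x)) \<le> C * best_n_term_error M p (e ` I) m f"
      using greedy img by simp
    also have "\<dots> \<le> max C 1 * best_n_term_error M p (e ` I) m f"
      by (intro mult_right_mono best_n_term_error_nonneg) simp
    finally show "Lp_norm M p (\<lambda>x. f x - (\<Sum>i\<in>\<Lambda>. c i * e i x))
      \<le> max C 1 * best_n_term_error M p (e ` I) m f" .
  next
    fix \<Lambda> assume \<Lambda>: "\<Lambda> \<subseteq> I" "finite \<Lambda>"
    have "Lp_norm M p (\<lambda>x. \<Sum>i\<in>\<Lambda>. e i x) \<le> hi * real (card \<Lambda>) powr (1 / p)"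
      using sums(2)[OF \<Lambda>] .
    also have "\<dots> \<le> max hi 0 * real (card \<Lambda>) powr (1 / p)"
      by (intro mult_right_mono) auto
    finally show "Lp_norm M p (\<lambda>x. \<Sum>i\<in>\<Lambda>. e i x) \<le> max hi 0 * real (card \<Lambda>) powr (1 / p)" .
  qed (use p basis inj lo sums in auto)
  then show thesis using that img by blast
qed

lemma normalized_local_structure:
  assumes "\<psi> \<in> Lp_normalize M p ` (\<Union>n. \<Phi> n)"
  shows "\<exists>C\<in>filt_atoms F. \<forall>R\<in>filt_atoms F \<union> filt_rings F.
    (\<exists>h\<in>S. AE x in M. x \<in> R \<longrightarrow> \<psi> x = h x) \<or> crosses F R C"
proof -
  obtain \<phi> where \<phi>: "\<phi> \<in> (\<Union>n. \<Phi> n)" "\<psi> = Lp_normalize M p \<phi>" using assms by blast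
  have "\<exists>h\<in>S. AE x in M. x \<in> R \<longrightarrow> \<psi> x = h x"
    if R: "\<exists>h\<in>S. AE x in M. x \<in> R \<longrightarrow> \<phi> x = h x" for R
  proof -
    obtain h where h: "h \<in> S" "AE x in M. x \<in> R \<longrightarrow> \<phi> x = h x" using R by blast
    let ?h = "\<lambda>x. of_real (inverse (Lp_norm M p \<phi>)) * h x"
    have "AE x in M. x \<in> R \<longrightarrow> \<psi> x = ?h x"
      using h(2) by (rule AE_mp) (auto simp: \<phi>(2) Lp_normalize_def scaleR_conv_of_real)
    then show ?thesis using S_cmult[OF h(1)] by (intro bexI[of _ ?h])
  qed
  then show ?thesis using Phi_local_structure[OF \<phi>(1)] by meson
qed

text \<open>
  The terms of the \<open>n\<close>-th partial sum that are in \<open>S\<close> on \<open>R\<close> do not contribute to the local error on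
  \<open>R\<close>. What is left is the remainder \<open>r n\<close>, which tends to \<open>0\<close>, and the combination of the exceptional
  terms \<open>Bad n R\<close>. Exchanging the sums over \<open>R\<close> and over the indices, each coefficient is counted at
  most twice.
\<close>

lemma local_error_sum_le:
  assumes greedy_sys: "greedy_Lp_basis M p (LpS M F S p) I e C lo hi"
    and img: "e ` I = Lp_normalize M p ` (\<Union>n. \<Phi> n)" and \<sigma>: "0 < \<sigma>"
    and K: "K \<ge> 0" "\<And>c \<Lambda>. \<Lambda> \<subseteq> I \<Longrightarrow> finite \<Lambda> \<Longrightarrow>
      Lp_norm M p (\<lambda>x. \<Sum>i\<in>\<Lambda>. c i * e i x) \<le> K * (\<Sum>i\<in>\<Lambda>. norm (c i) powr \<sigma>) powr (1 / \<sigma>)"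
    and f: "f \<in> LpS M F S p" "is_expansion M p I e f c"
    and B: "\<And>T. T \<subseteq> I \<Longrightarrow> finite T \<Longrightarrow> (\<Sum>i\<in>T. norm (c i) powr \<sigma>) \<le> B"
    and \<P>: "finite \<P>" "\<P> \<subseteq> filt_atoms F \<union> filt_rings F" "disjoint \<P>"
  shows "(\<Sum>R\<in>\<P>. local_error M S p f R powr \<sigma>) \<le> 2 * K powr \<sigma> * B"
proof -
  interpret greedy_Lp_basis M p "LpS M F S p" I e C lo hi by (rule greedy_sys)
  define good where "good i R \<longleftrightarrow> (\<exists>h\<in>S. AE x in M. x \<in> R \<longrightarrow> e i x = h x)" for i R
  define r where "r n = N (\<lambda>x. f x - (\<Sum>i<n. c i * e i x))" for n
  define E where "E R = local_error M S p f R" for R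
  define J where "J n = {..<n} \<inter> I" for n
  define Bad where "Bad n R = {i\<in>J n. \<not> good i R}" for n R
  have c0: "\<forall>i. i \<notin> I \<longrightarrow> c i = 0" and r_lim: "r \<longlonglongrightarrow> 0"
    using f(2) unfolding is_expansion_def r_def by blast+
  have J: "J n \<subseteq> I" "finite (J n)" for n by (auto simp: J_def)
  have Bad: "Bad n R \<subseteq> I" "finite (Bad n R)" for n R using J by (auto simp: Bad_def)
  have few: "card {R\<in>\<P>. \<not> good i R} \<le> 2" if "i \<in> I" for i
  proof -
    have "e i \<in> Lp_normalize M p ` (\<Union>n. \<Phi> n)" using that img by blast
    then obtain A where A: "A \<in> filt_atoms F"
      "\<And>R. R \<in> filt_atoms F \<union> filt_rings F \<Longrightarrow> good i R \<or> crosses F R A"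
      using normalized_local_structure unfolding good_def by meson
    have "{R\<in>\<P>. \<not> good i R} \<subseteq> {R\<in>\<P>. crosses F R A}" using A(2) \<P>(2) by blast
    then have "card {R\<in>\<P>. \<not> good i R} \<le> card {R\<in>\<P>. crosses F R A}"
      using \<P>(1) by (intro card_mono) auto
    also have "\<dots> \<le> 2" using A(1) \<P>(3) by (rule card_crossing_le_2)
    finally show ?thesis .
  qed
  have E_le: "E R \<le> r n + K * (\<Sum>i\<in>Bad n R. norm (c i) powr \<sigma>) powr (1 / \<sigma>)" if R: "R \<in> \<P>" for R n
  proof -
    have R_sets: "R \<in> sets M" using R \<P>(2) filt_atom_sets filt_ring_sets by blast
    define G where "G = J n - Bad n R"
    have "\<forall>i\<in>G. \<exists>h\<in>S. AE x in M. x \<in> R \<longrightarrow> e i x = h x"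
      by (auto simp: G_def Bad_def good_def)
    then obtain h where h: "\<And>i. i \<in> G \<Longrightarrow> h i \<in> S" "\<And>i. i \<in> G \<Longrightarrow> AE x in M. x \<in> R \<longrightarrow> e i x = h i x"
      by metis
    have finG: "finite G" "J n = G \<union> Bad n R" "G \<inter> Bad n R = {}"
      using J by (auto simp: G_def Bad_def)
    let ?h = "\<lambda>x. \<Sum>i\<in>G. c i * h i x"
    let ?t = "\<lambda>x. f x - (\<Sum>i<n. c i * e i x)"
    have hS: "?h \<in> S" using h(1) by (rule S_sum)
    have t: "?t \<in> LpS M F S p"
      using partial_sum_eq[OF c0, of n] comb_X[OF J, of c n] X_diff[OF f(1)] by (simp add: J_def)
    have rest: "(\<lambda>x. ?t x + comb c (Bad n R) x) \<in> LpS M F S p"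
      by (intro X_add t comb_X Bad)
    have "E R \<le> N (\<lambda>x. ?t x + comb c (Bad n R) x)"
      unfolding E_def
    proof (rule local_error_le[OF _ _ hS _ R_sets])
      show "f \<in> borel_measurable M" using f(1) X_Lp Lp_space_measurable by blast
      show "(\<lambda>x. ?t x + comb c (Bad n R) x) \<in> Lp_space M p" using rest X_Lp by blast
      show "?h \<in> borel_measurable M" using S_measurable[OF hS] .
      have "AE x in M. \<forall>i\<in>G. x \<in> R \<longrightarrow> e i x = h i x"
        using finG(1) h(2) by (intro AE_finite_allI) auto
      then show "AE x in M. x \<in> R \<longrightarrow> f x = ?h x + (?t x + comb c (Bad n R) x)"
      proof (rule AE_mp, intro AE_I2 impI)
        fix x assume x: "\<forall>i\<in>G. x \<in> R \<longrightarrow> e i x = h i x" "x \<in> R"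
        have "(\<Sum>i<n. c i * e i x) = comb c (J n) x"
          using fun_cong[OF partial_sum_eq[OF c0, of n], of x] by (simp add: J_def)
        also have "\<dots> = comb c G x + comb c (Bad n R) x"
          unfolding finG(2) using finG Bad by (intro sum.union_disjoint) auto
        also have "comb c G x = ?h x" using x by (intro sum.cong) auto
        finally show "f x = ?h x + (?t x + comb c (Bad n R) x)" by simp
      qed
    qed (use p in auto)
    also have "\<dots> \<le> r n + N (comb c (Bad n R))"
      unfolding r_def by (intro N_triangle t comb_X Bad)
    also have "N (comb c (Bad n R)) \<le> K * (\<Sum>i\<in>Bad n R. norm (c i) powr \<sigma>) powr (1 / \<sigma>)"
      by (rule K(2)[OF Bad])
    finally show ?thesis by simp
  qed
  have E_nonneg: "0 \<le> E R" for R
    unfolding E_def using S_zero by (intro local_error_nonneg) auto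
  \<comment> \<open>truncation at \<open>0\<close> keeps the base of the power nonnegative and is removed in the limit\<close>
  have bound: "(\<Sum>R\<in>\<P>. max (E R - r n) 0 powr \<sigma>) \<le> 2 * K powr \<sigma> * B" for n
  proof -
    have "(\<Sum>R\<in>\<P>. \<Sum>i\<in>Bad n R. norm (c i) powr \<sigma>)
        = (\<Sum>i\<in>J n. \<Sum>R\<in>{R\<in>\<P>. \<not> good i R}. norm (c i) powr \<sigma>)"
      unfolding Bad_def using \<P>(1) J(2) by (rule sum.swap_restrict)
    also have "\<dots> = (\<Sum>i\<in>J n. real (card {R\<in>\<P>. \<not> good i R}) * norm (c i) powr \<sigma>)" by simp
    also have "\<dots> \<le> (\<Sum>i\<in>J n. 2 * norm (c i) powr \<sigma>)"
    proof (intro sum_mono mult_right_mono)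
      fix i assume "i \<in> J n"
      then show "real (card {R\<in>\<P>. \<not> good i R}) \<le> 2" using few[of i] J(1)[of n] by auto
    qed simp
    also have "\<dots> = 2 * (\<Sum>i\<in>J n. norm (c i) powr \<sigma>)" by (simp add: sum_distrib_left)
    also have "\<dots> \<le> 2 * B" using B[OF J, of n] by simp
    finally have inner: "(\<Sum>R\<in>\<P>. \<Sum>i\<in>Bad n R. norm (c i) powr \<sigma>) \<le> 2 * B" .
    have "(\<Sum>R\<in>\<P>. max (E R - r n) 0 powr \<sigma>)
        \<le> (\<Sum>R\<in>\<P>. K powr \<sigma> * (\<Sum>i\<in>Bad n R. norm (c i) powr \<sigma>))"
    proof (rule sum_mono)
      fix R assume R: "R \<in> \<P>"
      have "max (E R - r n) 0 \<le> K * (\<Sum>i\<in>Bad n R. norm (c i) powr \<sigma>) powr (1 / \<sigma>)"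
        using E_le[OF R, of n] K(1) by simp
      then have "max (E R - r n) 0 powr \<sigma>
          \<le> (K * (\<Sum>i\<in>Bad n R. norm (c i) powr \<sigma>) powr (1 / \<sigma>)) powr \<sigma>"
        using \<sigma> by (intro powr_mono2) auto
      also have "\<dots> = K powr \<sigma> * (\<Sum>i\<in>Bad n R. norm (c i) powr \<sigma>)"
        using \<sigma> by (simp add: powr_mult powr_powr sum_nonneg)
      finally show "max (E R - r n) 0 powr \<sigma> \<le> K powr \<sigma> * (\<Sum>i\<in>Bad n R. norm (c i) powr \<sigma>)" .
    qed
    also have "\<dots> = K powr \<sigma> * (\<Sum>R\<in>\<P>. \<Sum>i\<in>Bad n R. norm (c i) powr \<sigma>)"
      by (simp add: sum_distrib_left)
    also have "\<dots> \<le> K powr \<sigma> * (2 * B)" using inner by (intro mult_left_mono) auto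
    finally show ?thesis by (simp add: mult_ac)
  qed
  have "(\<lambda>n. \<Sum>R\<in>\<P>. max (E R - r n) 0 powr \<sigma>) \<longlonglongrightarrow> (\<Sum>R\<in>\<P>. max (E R - 0) 0 powr \<sigma>)"
    using \<sigma> by (intro tendsto_sum tendsto_powr' tendsto_max tendsto_diff tendsto_const r_lim) auto
  then have "(\<Sum>R\<in>\<P>. max (E R - 0) 0 powr \<sigma>) \<le> 2 * K powr \<sigma> * B"
    by (rule LIMSEQ_le_const2) (use bound in auto)
  then show ?thesis using E_nonneg by (simp add: E_def)
qed

text \<open>
  Otherwise the normalization would be the zero function, against the lower Temlyakov bound for a
  single element.
\<close>

lemma Phi_norm_nonzero:
  assumes p: "1 < p" and \<phi>: "\<phi> \<in> (\<Union>n. \<Phi> n)"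
  shows "Lp_norm M p \<phi> \<noteq> 0"
proof
  assume "Lp_norm M p \<phi> = 0"
  then have zero: "Lp_normalize M p \<phi> = (\<lambda>x. 0)" by (simp add: Lp_normalize_def)
  obtain lo where "lo > 0" "\<And>\<Lambda>. \<Lambda> \<subseteq> Lp_normalize M p ` (\<Union>n. \<Phi> n) \<Longrightarrow> finite \<Lambda> \<Longrightarrow>
      lo * real (card \<Lambda>) powr (1 / p) \<le> Lp_norm M p (\<lambda>x. \<Sum>\<psi>\<in>\<Lambda>. \<psi> x)"
    using Phi_temlyakov[OF p] unfolding temlyakov_property_def by blast
  moreover have "{Lp_normalize M p \<phi>} \<subseteq> Lp_normalize M p ` (\<Union>n. \<Phi> n)" using \<phi> by blast
  ultimately have "lo * 1 \<le> Lp_norm M p (\<lambda>x. \<Sum>\<psi>\<in>{Lp_normalize M p \<phi>}. \<psi> x)" by force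
  then show False using \<open>lo > 0\<close> by (simp add: zero Lp_norm_zero)
qed

lemma variation_le_approx:
  assumes p: "1 < p" and \<sigma>: "0 < \<sigma>" "\<sigma> < p" and \<alpha>: "\<alpha> = 1 / \<sigma> - 1 / p" and q: "0 < q" "q \<le> \<sigma>"
  obtains K where "K \<ge> 0" "\<And>f. f \<in> LpS M F S p \<Longrightarrow>
    approx_norm M p (\<Union>n. \<Phi> n) \<alpha> q f < \<infinity> \<Longrightarrow>
    variation M F S \<sigma> p f \<le> ennreal K * approx_norm M p (\<Union>n. \<Phi> n) \<alpha> q f"
proof -
  obtain I e C lo hi where greedy_sys: "greedy_Lp_basis M p (LpS M F S p) I e C lo hi"
    and img: "e ` I = Lp_normalize M p ` (\<Union>n. \<Phi> n)"
    using greedy_basis_enumeration[OF p] by blast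
  interpret greedy_Lp_basis M p "LpS M F S p" I e C lo hi by (rule greedy_sys)
  obtain K1 where K1: "K1 \<ge> 0" "\<And>c \<Lambda>. \<Lambda> \<subseteq> I \<Longrightarrow> finite \<Lambda> \<Longrightarrow>
      N (comb c \<Lambda>) \<le> K1 * (\<Sum>i\<in>\<Lambda>. norm (c i) powr \<sigma>) powr (1 / \<sigma>)"
    using ell_sigma_upper[OF \<sigma>] by blast
  obtain K2 where K2: "K2 \<ge> 0" "\<And>f c T A. f \<in> LpS M F S p \<Longrightarrow> is_expansion M p I e f c \<Longrightarrow>
      T \<subseteq> I \<Longrightarrow> finite T \<Longrightarrow>
      (\<And>n. (\<Sum>m<n. (2 powr (real m * \<alpha>) * best_n_term_error M p (e ` I) (2 ^ m) f) powr \<sigma>) \<le> A) \<Longrightarrow>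
      (\<Sum>i\<in>T. norm (c i) powr \<sigma>) \<le> K2 * (N f powr \<sigma> + A)"
    using coefficients_ell_sigma[OF \<sigma>(1) \<alpha>] by blast
  define K where "K = (2 * K1 powr \<sigma> * K2 * 2) powr (1 / \<sigma>)"
  show thesis
  proof (rule that[of K])
    show "K \<ge> 0" by (simp add: K_def)
    fix f assume f: "f \<in> LpS M F S p" and fin: "approx_norm M p (\<Union>n. \<Phi> n) \<alpha> q f < \<infinity>"
    define a where "a n = 2 powr (real n * \<alpha>) * best_n_term_error M p (\<Union>n. \<Phi> n) (2 ^ n) f" for n
    have a: "a n \<ge> 0" for n by (simp add: a_def best_n_term_error_nonneg)
    have summable: "summable (\<lambda>n. a n powr q)"
      using fin a unfolding approx_norm_def lq_norm_def a_def[symmetric]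
      by (auto split: if_splits)
    define L where "L = (\<Sum>n. a n powr q) powr (1 / q)"
    have L: "L \<ge> 0" by (simp add: L_def)
    have norm_eq: "approx_norm M p (\<Union>n. \<Phi> n) \<alpha> q f = ennreal (N f + L)"
      using summable a L Lp_norm_nonneg[of M p f]
      unfolding approx_norm_def lq_norm_def a_def[symmetric] L_def by (simp add: ennreal_plus)
    have "\<exists>!c. is_expansion M p I e f c"
      using basis f by (simp add: is_schauder_basis_def)
    then obtain c where c: "is_expansion M p I e f c" by (rule ex1E)
    have err: "best_n_term_error M p (e ` I) m f \<le> best_n_term_error M p (\<Union>n. \<Phi> n) m f" for m
      unfolding img using Phi_norm_nonzero[OF assms(1)]
      by (intro best_n_term_error_antimono n_term_normalize) auto
    have A: "(\<Sum>m<n. (2 powr (real m * \<alpha>) * best_n_term_error M p (e ` I) (2 ^ m) f) powr \<sigma>) \<le> L powr \<sigma>" for n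
    proof -
      have "(\<Sum>m<n. (2 powr (real m * \<alpha>) * best_n_term_error M p (e ` I) (2 ^ m) f) powr \<sigma>)
          \<le> (\<Sum>m<n. a m powr \<sigma>)"
        unfolding a_def using err \<sigma>(1)
        by (intro sum_mono powr_mono2 mult_left_mono) (auto simp: best_n_term_error_nonneg)
      also have "\<dots> \<le> L powr \<sigma>"
        unfolding L_def using q a summable by (rule sum_powr_le_powr_sum)
      finally show ?thesis .
    qed
    have coeff: "(\<Sum>i\<in>T. norm (c i) powr \<sigma>) \<le> K2 * (N f powr \<sigma> + L powr \<sigma>)" if "T \<subseteq> I" "finite T" for T
      by (rule K2(2)[OF f c that A])
    have sum2: "N f powr \<sigma> + L powr \<sigma> \<le> 2 * (N f + L) powr \<sigma>"
      using powr_mono2[of \<sigma> "N f" "N f + L"] powr_mono2[of \<sigma> L "N f + L"] \<sigma>(1) L Lp_norm_nonneg[of M p f]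
      by simp
    have "(\<Sum>R\<in>\<P>. local_error M S p f R powr \<sigma>) powr (1 / \<sigma>) \<le> K * (N f + L)"
      if \<P>: "finite \<P>" "\<P> \<subseteq> filt_atoms F \<union> filt_rings F" "disjoint \<P>" for \<P>
    proof -
      have "(\<Sum>R\<in>\<P>. local_error M S p f R powr \<sigma>) \<le> 2 * K1 powr \<sigma> * (K2 * (N f powr \<sigma> + L powr \<sigma>))"
        by (rule local_error_sum_le[OF greedy_sys img \<sigma>(1) K1 f c coeff \<P>])
      also have "\<dots> \<le> 2 * K1 powr \<sigma> * (K2 * (2 * (N f + L) powr \<sigma>))"
        using sum2 K2(1) by (intro mult_left_mono) auto
      finally have "(\<Sum>R\<in>\<P>. local_error M S p f R powr \<sigma>) powr (1 / \<sigma>)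
          \<le> (2 * K1 powr \<sigma> * (K2 * (2 * (N f + L) powr \<sigma>))) powr (1 / \<sigma>)"
        using \<sigma>(1) by (intro powr_mono2 sum_nonneg) auto
      also have "2 * K1 powr \<sigma> * (K2 * (2 * (N f + L) powr \<sigma>)) = 2 * K1 powr \<sigma> * K2 * 2 * (N f + L) powr \<sigma>"
        by simp
      also have "(2 * K1 powr \<sigma> * K2 * 2 * (N f + L) powr \<sigma>) powr (1 / \<sigma>) = K * (N f + L)"
        using \<sigma>(1) L Lp_norm_nonneg[of M p f] unfolding K_def by (subst powr_mult) (simp add: powr_powr)
      finally show ?thesis .
    qed
    then have "variation M F S \<sigma> p f \<le> ennreal (K * (N f + L))"
      unfolding variation_def by (intro SUP_least ennreal_leI) blast
    also have "\<dots> = ennreal K * approx_norm M p (\<Union>n. \<Phi> n) \<alpha> q f"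
      using L Lp_norm_nonneg[of M p f] by (simp add: norm_eq ennreal_mult K_def)
    finally show "variation M F S \<sigma> p f \<le> ennreal K * approx_norm M p (\<Union>n. \<Phi> n) \<alpha> q f" .
  qed
qed

end

theorem theorem4p4:
  fixes M :: "'a measure" and F :: "nat \<Rightarrow> 'a measure" and \<nu> :: nat
    and S :: "('a \<Rightarrow> 'k::{real_normed_field, euclidean_space}) set"
    and \<Phi> :: "nat \<Rightarrow> ('a \<Rightarrow> 'k) set"
    and p \<sigma> \<alpha> q :: real
  assumes "local_orthonormal_system M F \<nu> S \<Phi>"
    and "1 < p" and "0 < \<sigma>" and "\<sigma> < p"
    and "\<alpha> = 1 / \<sigma> - 1 / p"
    and "q = min \<sigma> 2"
  shows "embeds_continuously
    (approx_space M p (LpS M F S p) (\<Union>n. \<Phi> n) \<alpha> q) (approx_norm M p (\<Union>n. \<Phi> n) \<alpha> q)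
    (variation_space M F S \<sigma> p) (variation_norm M F S \<sigma> p)"
proof -
  interpret local_orthonormal_system M F \<nu> S \<Phi> by fact
  let ?a = "approx_norm M p (\<Union>n. \<Phi> n) \<alpha> q"
  have q: "0 < q" "q \<le> \<sigma>" using assms by auto
  obtain K where K: "K \<ge> 0" "\<And>f. f \<in> LpS M F S p \<Longrightarrow> ?a f < \<infinity> \<Longrightarrow>
      variation M F S \<sigma> p f \<le> ennreal K * ?a f"
    using variation_le_approx[OF assms(2-5) q] by blast
  have le: "variation_norm M F S \<sigma> p f \<le> ennreal (1 + K) * ?a f"
    if "f \<in> approx_space M p (LpS M F S p) (\<Union>n. \<Phi> n) \<alpha> q" for f
  proof -
    have "ennreal (Lp_norm M p f) \<le> 1 * ?a f" by (simp add: approx_norm_def)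
    moreover have "variation M F S \<sigma> p f \<le> ennreal K * ?a f"
      using that K(2) by (simp add: approx_space_def)
    ultimately have "variation_norm M F S \<sigma> p f \<le> 1 * ?a f + ennreal K * ?a f"
      unfolding variation_norm_def by (rule add_mono)
    also have "\<dots> = ennreal (1 + K) * ?a f"
      using K(1) by (simp add: ennreal_plus distrib_right)
    finally show ?thesis .
  qed
  have "variation_norm M F S \<sigma> p f < \<infinity>"
    if "f \<in> approx_space M p (LpS M F S p) (\<Union>n. \<Phi> n) \<alpha> q" for f
  proof -
    have "ennreal (1 + K) * ?a f < \<infinity>"
      using that by (auto simp: approx_space_def ennreal_mult_less_top)
    then show ?thesis using le[OF that] by (rule le_less_trans[rotated])
  qed
  then show ?thesis
    unfolding embeds_continuously_def variation_space_def using le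
    by (auto simp: approx_space_def)
qed

end
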